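(* Let $X_{\mathbb{Z}}$ and $Y_{\mathbb{Z}}$ be finitely generated $\mathbb{Z}$-modules, let $f_{\mathbb{Z}}:X_{\mathbb{Z}}\to Y_{\mathbb{Z}}$ be a homomorphism with kernel $K_{\mathbb{Z}}$, so that $0\to K_{\mathbb{Z}}\to X_{\mathbb{Z}}\xrightarrow{f_{\mathbb{Z}}}\operatorname{im} f_{\mathbb{Z}}\to 0$ is exact, and let $c_{\mathbb{Z}}\in\operatorname{Hom}_{\mathbb{Z}}(X_{\mathbb{Z}},\mathbb{Z})$ and $b_{\mathbb{Z}}\in Y_{\mathbb{Z}}$. Then $$\max_{\lambda_{\mathbb{Z}}\in\operatorname{Hom}_{\mathbb{Z}}(Y_{\mathbb{Z}},\mathbb{Z})}\{-\langle b_{\mathbb{Z}},\lambda_{\mathbb{Z}}\rangle : c_{\mathbb{Z}}+f_{\mathbb{Z}}^{\top}\lambda_{\mathbb{Z}}=0\}$$ equals the primal integer optimum $$\min_{x\in X_{\mathbb{Z}}}\{\langle c_{\mathbb{Z}},x\rangle : f_{\mathbb{Z}}(x)=b_{\mathbb{Z}}\}$$ if and only if $\operatorname{Ext}^1_{\mathbb{Z}}(\operatorname{coker} f_{\mathbb{Z}},\mathbb{Z})=0$. Equivalently, $\operatorname{coker} f_{\mathbb{Z}}$ is torsion-free; this is characterized by the Smith normal form of $f_{\mathbb{Z}}$ having all invariant factors equal to $1$.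
   Context: $\langle\cdot,\cdot\rangle$ denotes the evaluation pairing between a $\mathbb{Z}$-module and its dual $\operatorname{Hom}_{\mathbb{Z}}(-,\mathbb{Z})$, and $f_{\mathbb{Z}}^{\top}\lambda_{\mathbb{Z}}=\lambda_{\mathbb{Z}}\circ f_{\mathbb{Z}}$. The invariant factors are the nonzero diagonal entries $d_i$ of the Smith normal form of a matrix presenting $f_{\mathbb{Z}}$.
   Formalization: Equality of optima is required for all c and b together (for one fixed pair the iff fails: f=2 on Z, c=0, b=0), with infinite values for infeasible or unbounded programs; pairs where both programs are infeasible are excluded (f=0 on Z, c=b=1). *)

theory Defs
  imports
    "HOL-Algebra.Free_Abelian_Groups"
    "HOL-Library.Extended_Real"
    "Jordan_Normal_Form.Matrix"
begin

text \<open>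
  A \<open>\<int>\<close>-module is an abelian group, i.e. a \<^const>\<open>comm_group\<close> of HOL-Algebra, written
  multiplicatively (the scalar action is \<open>x [^] n\<close> with \<open>n\<close> an integer); \<open>\<int>\<close>-linear maps are the
  elements of \<^const>\<open>hom\<close>, and \<open>\<int>\<close> itself is \<^const>\<open>integer_group\<close>, whose operation is
  addition.
\<close>

definition finitely_generated :: "('a, 'm) monoid_scheme \<Rightarrow> bool" where
  "finitely_generated G \<longleftrightarrow> (\<exists>S. finite S \<and> S \<subseteq> carrier G \<and> generate G S = carrier G)"

definition torsion_free :: "('a, 'm) monoid_scheme \<Rightarrow> bool" where
  "torsion_free G \<longleftrightarrow>
     (\<forall>x \<in> carrier G. \<forall>n::int. n \<noteq> 0 \<longrightarrow> x [^]\<^bsub>G\<^esub> n = \<one>\<^bsub>G\<^esub> \<longrightarrow> x = \<one>\<^bsub>G\<^esub>)"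

definition coker ::
    "('a, 'm) monoid_scheme \<Rightarrow> ('b, 'n) monoid_scheme \<Rightarrow> ('a \<Rightarrow> 'b) \<Rightarrow> 'b set monoid" where
  "coker XZ YZ f = YZ Mod (f ` carrier XZ)"


section \<open>Ext\<close>

text \<open>
  Homomorphisms are taken extensional here, so that two of them are equal as soon as they agree on
  the carrier of the source.
\<close>

definition hom_group ::
    "('a, 'm) monoid_scheme \<Rightarrow> ('b, 'n) monoid_scheme \<Rightarrow> ('a \<Rightarrow> 'b) monoid" where
  "hom_group G A =
     \<lparr>carrier = hom G A \<inter> extensional (carrier G),
      monoid.mult = (\<lambda>\<phi> \<psi>. \<lambda>x\<in>carrier G. \<phi> x \<otimes>\<^bsub>A\<^esub> \<psi> x),
      one = (\<lambda>x\<in>carrier G. \<one>\<^bsub>A\<^esub>)\<rparr>"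

text \<open>
  \<open>free_cover C\<close> is the canonical surjection onto \<open>C\<close> from the free abelian group \<open>F\<close> on the
  elements of \<open>C\<close>. With \<open>R\<close> its kernel, which is again free, \<open>0 \<rightarrow> R \<rightarrow> F \<rightarrow> C \<rightarrow> 0\<close> is a free
  resolution of \<open>C\<close>. Applying \<open>Hom(_, A)\<close> to \<open>0 \<rightarrow> R \<rightarrow> F\<close> gives the complex
  \<open>Hom(F, A) \<rightarrow> Hom(R, A) \<rightarrow> 0\<close>, whose cohomology in degree 1 is the quotient of \<open>Hom(R, A)\<close> by the
  restrictions of homomorphisms defined on \<open>F\<close>.
\<close>

definition free_cover :: "('a, 'm) monoid_scheme \<Rightarrow> ('a \<Rightarrow>\<^sub>0 int) \<Rightarrow> 'a" where
  "free_cover C v =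
     finprod C (\<lambda>a. a [^]\<^bsub>C\<^esub> Poly_Mapping.lookup v a) (Poly_Mapping.keys v)"

definition free_relations :: "('a, 'm) monoid_scheme \<Rightarrow> ('a \<Rightarrow>\<^sub>0 int) set" where
  "free_relations C = kernel (free_Abelian_group (carrier C)) C (free_cover C)"

definition Ext1 ::
    "('a, 'm) monoid_scheme \<Rightarrow> ('b, 'n) monoid_scheme \<Rightarrow> (('a \<Rightarrow>\<^sub>0 int) \<Rightarrow> 'b) set monoid" where
  "Ext1 C A =
     (let F = free_Abelian_group (carrier C); R = free_relations C
      in hom_group (F\<lparr>carrier := R\<rparr>) A Mod ((\<lambda>\<psi>. restrict \<psi> R) ` carrier (hom_group F A)))"


section \<open>The primal and the dual integer program\<close>

definition primal_feasible ::
    "('a, 'm) monoid_scheme \<Rightarrow> ('a \<Rightarrow> 'b) \<Rightarrow> 'b \<Rightarrow> 'a set" where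
  "primal_feasible XZ f b = {x \<in> carrier XZ. f x = b}"

definition dual_feasible ::
    "('a, 'm) monoid_scheme \<Rightarrow> ('b, 'n) monoid_scheme \<Rightarrow> ('a \<Rightarrow> 'b) \<Rightarrow> ('a \<Rightarrow> int) \<Rightarrow> ('b \<Rightarrow> int) set"
  where
  "dual_feasible XZ YZ f c =
     {l \<in> hom YZ integer_group. \<forall>x \<in> carrier XZ. c x + (l \<circ> f) x = 0}"

text \<open>
  Optimal values are extended reals with the usual conventions: an infeasible minimization has value
  \<open>\<infinity>\<close>, an infeasible maximization has value \<open>-\<infinity>\<close>, and unbounded programs have value \<open>-\<infinity>\<close> and
  \<open>\<infinity>\<close> respectively. The objectives are integral, so a finite value is always attained and is a
  minimum or maximum (\<open>int_INF_attained\<close>, \<open>int_SUP_attained\<close> below). If both programs are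
  infeasible the values are \<open>\<infinity>\<close> and \<open>-\<infinity>\<close>, whatever the cokernel is; as usual in linear
  programming duality, this case has to be excluded when the two values are compared.
\<close>

definition primal_value ::
    "('a, 'm) monoid_scheme \<Rightarrow> ('a \<Rightarrow> 'b) \<Rightarrow> 'b \<Rightarrow> ('a \<Rightarrow> int) \<Rightarrow> ereal" where
  "primal_value XZ f b c = (INF x \<in> primal_feasible XZ f b. ereal (of_int (c x)))"

definition dual_value ::
    "('a, 'm) monoid_scheme \<Rightarrow> ('b, 'n) monoid_scheme \<Rightarrow> ('a \<Rightarrow> 'b) \<Rightarrow> 'b \<Rightarrow> ('a \<Rightarrow> int) \<Rightarrow> ereal"
  where
  "dual_value XZ YZ f b c = (SUP l \<in> dual_feasible XZ YZ f c. ereal (of_int (- l b)))"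

lemma int_SUP_attained:
  fixes g :: "'a \<Rightarrow> int"
  assumes "\<bar>SUP x\<in>S. ereal (of_int (g x))\<bar> \<noteq> \<infinity>"
  shows "\<exists>x\<in>S. ereal (of_int (g x)) = (SUP x\<in>S. ereal (of_int (g x)))"
proof -
  obtain r where r: "(SUP x\<in>S. ereal (of_int (g x))) = ereal r"
    using assms by auto
  have "ereal (r - 1) < (SUP x\<in>S. ereal (of_int (g x)))"
    by (simp add: r)
  then obtain x where x: "x \<in> S" "r - 1 < of_int (g x)"
    by (auto simp: less_SUP_iff)
  have le: "of_int (g y) \<le> r" if "y \<in> S" for y
    using SUP_upper[OF that, of "\<lambda>x. ereal (of_int (g x))"] r by simp
  have "g y \<le> g x" if "y \<in> S" for y
    using le[OF that] x(2) by linarith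
  then have "(SUP x\<in>S. ereal (of_int (g x))) = ereal (of_int (g x))"
    using x(1) by (intro antisym SUP_least SUP_upper) auto
  then show ?thesis
    using x(1) by metis
qed

lemma int_INF_attained:
  fixes g :: "'a \<Rightarrow> int"
  assumes "\<bar>INF x\<in>S. ereal (of_int (g x))\<bar> \<noteq> \<infinity>"
  shows "\<exists>x\<in>S. ereal (of_int (g x)) = (INF x\<in>S. ereal (of_int (g x)))"
proof -
  obtain r where r: "(INF x\<in>S. ereal (of_int (g x))) = ereal r"
    using assms by auto
  have "(INF x\<in>S. ereal (of_int (g x))) < ereal (r + 1)"
    by (simp add: r)
  then obtain x where x: "x \<in> S" "of_int (g x) < r + 1"
    by (auto simp: INF_less_iff)
  have le: "r \<le> of_int (g y)" if "y \<in> S" for y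
    using INF_lower[OF that, of "\<lambda>x. ereal (of_int (g x))"] r by simp
  have "g x \<le> g y" if "y \<in> S" for y
    using le[OF that] x(2) by linarith
  then have "(INF x\<in>S. ereal (of_int (g x))) = ereal (of_int (g x))"
    using x(1) by (intro antisym INF_greatest INF_lower) auto
  then show ?thesis
    using x(1) by metis
qed


section \<open>Smith normal form\<close>

definition smith_normal_form :: "int mat \<Rightarrow> int mat \<Rightarrow> bool" where
  "smith_normal_form A D \<longleftrightarrow>
     (\<exists>P \<in> carrier_mat (dim_row A) (dim_row A). \<exists>Q \<in> carrier_mat (dim_col A) (dim_col A).
        invertible_mat P \<and> invertible_mat Q \<and> D = P * A * Q) \<and>
     diagonal_mat D \<and>
     (\<forall>i < min (dim_row D) (dim_col D). 0 \<le> D $$ (i, i)) \<and>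
     (\<forall>i. Suc i < min (dim_row D) (dim_col D) \<longrightarrow> D $$ (i, i) dvd D $$ (Suc i, Suc i))"

definition invariant_factors :: "int mat \<Rightarrow> int set" where
  "invariant_factors D = {D $$ (i, i) | i. i < min (dim_row D) (dim_col D) \<and> D $$ (i, i) \<noteq> 0}"

definition lin_comb :: "('a, 'm) monoid_scheme \<Rightarrow> 'a list \<Rightarrow> int vec \<Rightarrow> 'a" where
  "lin_comb G gs v = finprod G (\<lambda>i. gs ! i [^]\<^bsub>G\<^esub> (v $ i)) {..<length gs}"

text \<open>
  \<open>A\<close> presents \<open>f\<close> if it arises from generators \<open>xs\<close> of \<open>XZ\<close> and \<open>ys\<close> of \<open>YZ\<close> as the block matrix
  \<open>[M | R]\<close>, where column \<open>j\<close> of \<open>M\<close> expresses \<open>f (xs ! j)\<close> in terms of \<open>ys\<close> and the columns of \<open>R\<close>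
  generate the relations among \<open>ys\<close>. When \<open>ys\<close> is a basis of a free module \<open>YZ\<close> there are no relations,
  \<open>R\<close> may be taken with no columns, and \<open>A = M\<close> is the ordinary matrix of \<open>f\<close>. For \<open>YZ\<close> with torsion
  the block \<open>R\<close> is indispensable: the Smith normal form of \<open>M\<close> alone depends on the choice of the
  representing columns (both \<open>[1]\<close> and \<open>[3]\<close> represent the projection of \<open>\<int>\<close> onto \<open>\<int>/2\<close>).
\<close>

definition presents ::
    "int mat \<Rightarrow> ('a, 'm) monoid_scheme \<Rightarrow> ('b, 'n) monoid_scheme \<Rightarrow> ('a \<Rightarrow> 'b) \<Rightarrow> bool" where
  "presents A XZ YZ f \<longleftrightarrow>
     (\<exists>xs ys k. \<exists>M \<in> carrier_mat (length ys) (length xs). \<exists>R \<in> carrier_mat (length ys) k.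
        set xs \<subseteq> carrier XZ \<and> generate XZ (set xs) = carrier XZ \<and>
        set ys \<subseteq> carrier YZ \<and> generate YZ (set ys) = carrier YZ \<and>
        (\<forall>j < length xs. lin_comb YZ ys (col M j) = f (xs ! j)) \<and>
        {v \<in> carrier_vec (length ys). lin_comb YZ ys v = \<one>\<^bsub>YZ\<^esub>} = {R *\<^sub>v w | w. w \<in> carrier_vec k} \<and>
        A = four_block_mat M R (0\<^sub>m 0 (length xs)) (0\<^sub>m 0 k))"

end

theory Submission
  imports Defs
begin

text \<open>
  Write \<open>C\<close> for the cokernel of \<open>f\<close>. Everything rests on two consequences of the decomposition of
  finitely generated abelian groups into cyclic ones (\<open>cyclic_decomposition\<close>): a finitely generated
  torsion-free group is projective (\<open>torsion_free_section\<close>), and an element other than the neutral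
  one is detected by a homomorphism into some \<open>\<int>/m\<close> (\<open>separating_character\<close>).

  If \<open>C\<close> is torsion-free, projectivity splits both the free resolution of \<open>C\<close>, so that its \<open>Ext\<close>
  into \<open>\<int>\<close> vanishes (\<open>trivial_Ext1_if_torsion_free\<close>), and the projection of \<open>YZ\<close> onto \<open>C\<close>, so that
  the image of \<open>f\<close> is a direct summand of \<open>YZ\<close>. Functionals then extend from the image to \<open>YZ\<close>, and
  the dual is feasible as soon as \<open>c\<close> vanishes on the kernel of \<open>f\<close>. Together with the fact that
  functionals separate the points of \<open>C\<close>, which makes the dual unbounded when only the primal is
  infeasible, this gives equality of the optimal values (\<open>duality_if_torsion_free_coker\<close>).

  If \<open>C\<close> has torsion, a torsion element \<open>b\<close> is invisible to every integer-valued functional that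
  vanishes on the image of \<open>f\<close>. So for \<open>c = 0\<close> the dual value is \<open>0\<close>, while the primal is infeasible
  (\<open>torsion_free_coker_if_duality\<close>). But the torsion element is detected by a character modulo some
  \<open>m\<close>, and lifting that character to the free group of the resolution and dividing by \<open>m\<close> yields a
  nonzero class in \<open>Ext\<close> (\<open>torsion_free_if_trivial_Ext1\<close>).

  For the matrix criterion, a presentation \<open>A\<close> identifies \<open>C\<close> with the quotient of a lattice of
  integer vectors by the lattice spanned by the columns of \<open>A\<close>. Torsion-freeness of this quotient
  is invariant under multiplication of \<open>A\<close> by invertible matrices
  (\<open>saturated_column_lattice_equivalent\<close>), and for a diagonal matrix it can be read off the entries
  (\<open>saturated_diagonal_iff\<close>).
\<close>

section \<open>Finitely generated abelian groups\<close>

definition int_comb :: "('a, 'm) monoid_scheme \<Rightarrow> 'i set \<Rightarrow> ('i \<Rightarrow> 'a) \<Rightarrow> ('i \<Rightarrow> int) \<Rightarrow> 'a" where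
  "int_comb G I g v = finprod G (\<lambda>i. g i [^]\<^bsub>G\<^esub> v i) I"

lemma int_comb_cong:
  assumes "comm_group G" "g \<in> I \<rightarrow> carrier G" "\<And>i. i \<in> I \<Longrightarrow> h i = g i" "\<And>i. i \<in> I \<Longrightarrow> w i = v i"
  shows "int_comb G I h w = int_comb G I g v"
proof -
  interpret comm_group G by fact
  show ?thesis
    unfolding int_comb_def by (rule finprod_cong') (use assms in auto)
qed

context comm_group
begin

lemma int_comb_closed [simp]: "g \<in> I \<rightarrow> carrier G \<Longrightarrow> int_comb G I g v \<in> carrier G"
  unfolding int_comb_def by (intro finprod_closed) auto

lemma int_comb_add:
  "g \<in> I \<rightarrow> carrier G \<Longrightarrow>
    int_comb G I g (\<lambda>i. v i + w i) = int_comb G I g v \<otimes> int_comb G I g w"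
  unfolding int_comb_def
  by (subst finprod_multf [symmetric]) (auto intro!: finprod_cong' int_pow_mult)

lemma int_comb_zero: "(\<And>i. i \<in> I \<Longrightarrow> v i = 0) \<Longrightarrow> int_comb G I g v = \<one>"
  unfolding int_comb_def by (rule finprod_one_eqI) simp

lemma int_comb_smult:
  assumes "g \<in> I \<rightarrow> carrier G"
  shows "int_comb G I g (\<lambda>i. v i * k) = int_comb G I g v [^] k"
  unfolding int_comb_def using assms
  by (induction I rule: infinite_finite_induct)
     (auto simp: int_pow_distrib int_pow_pow Pi_iff int_pow_one)

lemma int_comb_uminus:
  assumes "g \<in> I \<rightarrow> carrier G"
  shows "int_comb G I g (\<lambda>i. - v i) = inv (int_comb G I g v)"
  using int_comb_smult [OF assms, of v "- 1"] assms by (simp add: int_pow_neg)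

lemma int_comb_remove:
  assumes "finite I" "i \<in> I" "g \<in> I \<rightarrow> carrier G"
  shows "int_comb G I g v = g i [^] v i \<otimes> int_comb G (I - {i}) g v"
proof -
  have "int_comb G (insert i (I - {i})) g v = g i [^] v i \<otimes> int_comb G (I - {i}) g v"
    unfolding int_comb_def by (rule finprod_insert) (use assms in auto)
  then show ?thesis
    using assms by (simp add: insert_absorb)
qed

lemma int_comb_single:
  assumes "finite I" "i \<in> I" "g \<in> I \<rightarrow> carrier G" "\<And>j. j \<in> I \<Longrightarrow> j \<noteq> i \<Longrightarrow> v j = 0"
  shows "int_comb G I g v = g i [^] v i"
  using int_comb_remove [OF assms(1-3), of v] int_comb_zero [of "I - {i}" v g] assms
  by (auto simp: Pi_iff)

text \<open>
  An integer matrix acts on families of group elements by forming integer combinations, and this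
  is exchanging a double product.
\<close>

lemma int_comb_swap:
  assumes "finite J" "g \<in> I \<rightarrow> carrier G"
  shows "int_comb G I g (\<lambda>i. \<Sum>j\<in>J. m i j * w j) = int_comb G J (\<lambda>j. int_comb G I g (\<lambda>i. m i j)) w"
  using assms(1)
proof (induction J)
  case empty
  show ?case
    by (simp add: int_comb_zero) (simp add: int_comb_def)
next
  case (insert j J)
  have "int_comb G I g (\<lambda>i. \<Sum>j\<in>insert j J. m i j * w j)
      = int_comb G I g (\<lambda>i. m i j) [^] w j \<otimes> int_comb G J (\<lambda>j. int_comb G I g (\<lambda>i. m i j)) w"
    using insert assms by (simp add: int_comb_add int_comb_smult)
  also have "\<dots> = int_comb G (insert j J) (\<lambda>j. int_comb G I g (\<lambda>i. m i j)) w"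
    by (subst int_comb_remove [of "insert j J" j]) (use insert assms in auto)
  finally show ?case .
qed

lemma hom_int_comb:
  assumes "h \<in> hom G H" "comm_group H" "g \<in> I \<rightarrow> carrier G"
  shows "h (int_comb G I g v) = int_comb H I (\<lambda>i. h (g i)) v"
proof -
  interpret H: comm_group H by fact
  have hg: "group_hom G H h"
    using assms by unfold_locales
  show ?thesis
    using assms(3) unfolding int_comb_def
  proof (induction I rule: infinite_finite_induct)
    case (insert i I)
    then have "\<And>j. j \<in> insert i I \<Longrightarrow> h (g j) \<in> carrier H"
      using assms(1) by (auto simp: hom_def)
    then show ?case
      using insert
      by (subst finprod_insert; (subst H.finprod_insert)?)
         (auto simp: group_hom.hom_int_pow [OF hg] group_hom.hom_mult [OF hg] Pi_iff)
  qed (use group_hom.hom_one [OF hg] in auto)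
qed

lemma generate_eq_int_comb:
  assumes "finite I" "g \<in> I \<rightarrow> carrier G"
  shows "generate G (g ` I) = range (int_comb G I g)"
proof
  show "generate G (g ` I) \<subseteq> range (int_comb G I g)"
  proof
    fix x assume "x \<in> generate G (g ` I)"
    then show "x \<in> range (int_comb G I g)"
    proof induction
      case one
      then show ?case
        using int_comb_zero [of I "\<lambda>_. 0" g] by (metis rangeI)
    next
      case (incl x)
      then obtain i where "i \<in> I" "x = g i"
        by auto
      then have "int_comb G I g (\<lambda>j. if j = i then 1 else 0) = x"
        using int_comb_single [OF assms(1) _ assms(2), of i "\<lambda>j. if j = i then 1 else 0"] assms
        by (auto simp: Pi_iff)
      then show ?case
        by (metis rangeI)
    next
      case (inv x)
      then obtain i where "i \<in> I" "x = g i"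
        by auto
      then have "int_comb G I g (\<lambda>j. if j = i then -1 else 0) = inv x"
        using int_comb_single [OF assms(1) _ assms(2), of i "\<lambda>j. if j = i then -1 else 0"] assms
        by (auto simp: Pi_iff int_pow_neg)
      then show ?case
        by (metis rangeI)
    next
      case (eng x y)
      then obtain v w where "x = int_comb G I g v" "y = int_comb G I g w"
        by auto
      then have "x \<otimes> y = int_comb G I g (\<lambda>i. v i + w i)"
        using int_comb_add [OF assms(2)] by simp
      then show ?case
        by (metis rangeI)
    qed
  qed
  have sg: "subgroup (generate G (g ` I)) G"
    by (rule generate_is_subgroup) (use assms in auto)
  have "int_comb G J g v \<in> generate G (g ` I)" if "finite J" "J \<subseteq> I" for J v
    using that
  proof (induction J)
    case (insert j J)
    then have "g j [^] v j \<in> generate G (g ` I)"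
      using sg by (intro subgroup_int_pow_closed) (auto intro: generate.incl)
    then show ?case
      using insert assms
      by (subst int_comb_remove [of "insert j J" j]) (auto intro: generate.eng)
  qed (simp add: int_comb_def generate.one)
  then show "range (int_comb G I g) \<subseteq> generate G (g ` I)"
    using assms by auto
qed

lemma generate_Un_cong:
  assumes "A \<subseteq> carrier G" "B \<subseteq> carrier G" "C \<subseteq> carrier G" "generate G B = generate G C"
  shows "generate G (A \<union> B) = generate G (A \<union> C)"
proof -
  have "generate G (A \<union> B) \<subseteq> generate G (A \<union> C)"
    if "B \<subseteq> carrier G" "C \<subseteq> carrier G" "generate G B = generate G C" for B C
  proof (rule generate_subgroup_incl)
    have "B \<subseteq> generate G (A \<union> C)"
      using mono_generate [of C "A \<union> C"] that(3) by (auto intro: generate.incl)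
    then show "A \<union> B \<subseteq> generate G (A \<union> C)"
      by (auto intro: generate.incl)
    show "subgroup (generate G (A \<union> C)) G"
      using assms(1) that by (intro generate_is_subgroup) auto
  qed
  from this [of B C] this [of C B] assms show ?thesis
    by auto
qed

text \<open>
  Replacing one generator \<open>h i\<close> by a combination in which it occurs with coefficient \<open>1\<close> is an
  elementary column operation on the generators; the coefficients undergo the dual operation, so
  the generated subgroup stays the same.
\<close>

lemma int_comb_transvection:
  assumes "finite I" "i \<in> I" "h \<in> I \<rightarrow> carrier G" "q i = 1"
  shows "int_comb G I (h(i := int_comb G I h q)) w
       = int_comb G I h (\<lambda>j. if j = i then w i else w j + q j * w i)"
proof -
  have "int_comb G I h (\<lambda>j. if j = i then w i else w j + q j * w i)
      = int_comb G I h (\<lambda>j. q j * w i + (if j = i then 0 else w j))"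
    by (rule int_comb_cong) (use assms in \<open>auto simp: comm_group_axioms\<close>)
  also have "\<dots> = int_comb G I h q [^] w i \<otimes> int_comb G I h (\<lambda>j. if j = i then 0 else w j)"
    using assms by (simp add: int_comb_add int_comb_smult)
  also have "int_comb G I h (\<lambda>j. if j = i then 0 else w j)
      = int_comb G (I - {i}) h (\<lambda>j. if j = i then 0 else w j)"
    using assms by (subst int_comb_remove [of I i]) (auto simp: Pi_iff)
  also have "\<dots> = int_comb G (I - {i}) (h(i := int_comb G I h q)) w"
    by (rule int_comb_cong) (use assms in \<open>auto simp: comm_group_axioms\<close>)
  also have "int_comb G I h q [^] w i \<otimes> \<dots> = int_comb G I (h(i := int_comb G I h q)) w"
    using assms by (subst int_comb_remove [of I i]) auto
  finally show ?thesis ..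
qed

text \<open>
  The structure of finitely generated abelian groups: suitable generators satisfy only those
  relations that hold in each coordinate separately, so the generated group is the direct product
  of the cyclic groups spanned by the \<open>h i\<close>, of order \<open>\<bar>d i\<bar>\<close>, or infinite if \<open>d i = 0\<close>.

  Among all relations between all generating families indexed by \<open>I\<close>, take a nonzero coefficient
  \<open>e = v i\<close> of least absolute value. Division with remainder by \<open>e\<close> can never leave a nonzero
  remainder as a coefficient of a relation. Dividing the other coefficients of \<open>v\<close> by \<open>e\<close>, and
  moving the quotients into the generator \<open>h i\<close>, therefore turns the relation into
  \<open>h i [^] e = \<one>\<close> for the modified generator; dividing the \<open>i\<close>-th coefficient of any other relation
  by \<open>e\<close> shows that it is a multiple of \<open>e\<close>. Thus \<open>h i\<close> splits off, and the remaining generators are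
  handled by induction.
\<close>

theorem cyclic_decomposition:
  assumes "finite I" "g \<in> I \<rightarrow> carrier G"
  obtains h d where "h \<in> I \<rightarrow> carrier G" "generate G (h ` I) = generate G (g ` I)"
    "\<And>v. int_comb G I h v = \<one> \<longleftrightarrow> (\<forall>i\<in>I. d i dvd v i)"
proof -
  have "\<exists>h d. h \<in> I \<rightarrow> carrier G \<and> generate G (h ` I) = generate G (g ` I) \<and>
      (\<forall>v. int_comb G I h v = \<one> \<longleftrightarrow> (\<forall>i\<in>I. d i dvd v i))"
    using assms
  proof (induction I arbitrary: g rule: finite_psubset_induct)
    case (psubset I)
    define adm where
      "adm h \<longleftrightarrow> h \<in> I \<rightarrow> carrier G \<and> generate G (h ` I) = generate G (g ` I)" for h
    define rel where "rel h v i \<longleftrightarrow> adm h \<and> int_comb G I h v = \<one> \<and> i \<in> I \<and> v i \<noteq> 0" for h v i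
    show ?case
    proof (cases "\<exists>h v i. rel h v i")
      case False
      then have "int_comb G I g v = \<one> \<longleftrightarrow> (\<forall>i\<in>I. 0 dvd v i)" for v
        using psubset.prems int_comb_zero [of I v g] by (auto simp: rel_def adm_def)
      then show ?thesis
        using psubset.prems by (intro exI [of _ g] exI [of _ "\<lambda>_. 0"]) auto
    next
      case True
      then obtain t where "case t of (h, v, i) \<Rightarrow> rel h v i"
        by auto
      from ex_has_least_nat [of "\<lambda>(h, v, i). rel h v i", OF this, of "\<lambda>(h, v, i). nat \<bar>v i\<bar>"]
      obtain h v i where hvi: "rel h v i"
        and least: "\<And>h' v' i'. rel h' v' i' \<Longrightarrow> nat \<bar>v i\<bar> \<le> nat \<bar>v' i'\<bar>"
        by (auto simp: split_paired_all)
      define e where "e = v i"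
      define q where "q = (\<lambda>j. if j = i then 1 else v j div e)"
      define h1 where "h1 = h(i := int_comb G I h q)"
      have fin: "finite I" and i: "i \<in> I" and e: "e \<noteq> 0" and h: "h \<in> I \<rightarrow> carrier G"
        and genh: "generate G (h ` I) = generate G (g ` I)" and relv: "int_comb G I h v = \<one>"
        using psubset.hyps hvi by (auto simp: rel_def adm_def e_def)
      have h1: "h1 \<in> I \<rightarrow> carrier G"
        using h by (auto simp: h1_def)
      have trans: "int_comb G I h1 w
          = int_comb G I h (\<lambda>j. if j = i then w i else w j + q j * w i)" for w
        unfolding h1_def by (rule int_comb_transvection) (use fin i h in \<open>auto simp: q_def\<close>)
      have "range (int_comb G I h1) = range (int_comb G I h)"
      proof (intro subset_antisym subsetI)
        fix x assume "x \<in> range (int_comb G I h)"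
        then obtain w where w: "x = int_comb G I h w"
          by auto
        have "x = int_comb G I h1 (\<lambda>j. if j = i then w i else w j - q j * w i)"
          unfolding trans w by (rule int_comb_cong) (use h in \<open>auto simp: comm_group_axioms\<close>)
        then show "x \<in> range (int_comb G I h1)"
          by auto
      qed (auto simp: trans)
      then have genh1: "generate G (h1 ` I) = generate G (g ` I)"
        using generate_eq_int_comb [OF fin h] generate_eq_int_comb [OF fin h1] genh by simp
      then have adm1: "adm h1"
        using h1 by (simp add: adm_def)
      \<comment> \<open>minimality of \<open>e\<close>, applied to relations between the modified generators\<close>
      have small: "w j = 0" if "int_comb G I h1 w = \<one>" "j \<in> I" "\<bar>w j\<bar> < \<bar>e\<bar>" for w j
        using least [of h1 w j] that adm1 unfolding rel_def e_def by linarith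
      have abs_mod: "\<bar>k mod e\<bar> < \<bar>e\<bar>" for k
        using e by (simp add: abs_mod_less)
      have "int_comb G I h1 (\<lambda>j. if j = i then e else v j mod e) = int_comb G I h v"
        unfolding trans
      proof (rule int_comb_cong [OF comm_group_axioms h])
        fix j
        have "v j mod e + v j div e * e = v j"
          by (rule mod_div_mult_eq)
        then show "(if j = i then (if i = i then e else v i mod e)
            else (if j = i then e else v j mod e) + q j * (if i = i then e else v i mod e)) = v j"
          by (simp add: q_def flip: e_def)
      qed simp
      then have rel1: "int_comb G I h1 (\<lambda>j. if j = i then e else v j mod e) = \<one>"
        using relv by simp
      have "v j mod e = 0" if "j \<in> I" "j \<noteq> i" for j
        using small [OF rel1 that(1)] that abs_mod by simp
      then have tors: "h1 i [^] e = \<one>"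
        using rel1 by (subst (asm) int_comb_single [OF fin i h1]) auto
      then have tors_mult: "h1 i [^] (e * k) = \<one>" for k
        using h1 i by (metis PiE int_pow_one int_pow_pow)
      have dvd1: "e dvd w i" if "int_comb G I h1 w = \<one>" for w
      proof -
        have "int_comb G I h1 w = int_comb G I h1 (\<lambda>j. (if j = i then w i mod e else w j) +
            (if j = i then e * (w i div e) else 0))"
          by (rule int_comb_cong) (use h1 in \<open>auto simp: comm_group_axioms\<close>)
        also have "\<dots> = int_comb G I h1 (\<lambda>j. if j = i then w i mod e else w j)"
          using fin i h1 by (simp add: int_comb_add int_comb_single [of I i] tors_mult)
        finally have "w i mod e = 0"
          using small [of "\<lambda>j. if j = i then w i mod e else w j" i] that i abs_mod by simp
        then show ?thesis
          by auto
      qed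
      have I': "I - {i} \<subset> I" "h1 \<in> I - {i} \<rightarrow> carrier G"
        using i h1 by auto
      obtain h2 d where h2: "h2 \<in> I - {i} \<rightarrow> carrier G"
        and gen2: "generate G (h2 ` (I - {i})) = generate G (h1 ` (I - {i}))"
        and rel2: "\<And>v. int_comb G (I - {i}) h2 v = \<one> \<longleftrightarrow> (\<forall>j\<in>I - {i}. d j dvd v j)"
        using psubset.IH [OF I'] by blast
      define h3 where "h3 = h2(i := h1 i)"
      have h3: "h3 \<in> I \<rightarrow> carrier G"
        using h1 h2 i by (auto simp: h3_def)
      have "h3 ` I = {h1 i} \<union> h2 ` (I - {i})" "h1 ` I = {h1 i} \<union> h1 ` (I - {i})"
        using i by (auto simp: h3_def)
      then have gen3: "generate G (h3 ` I) = generate G (g ` I)"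
        using generate_Un_cong [of "{h1 i}", OF _ _ _ gen2] h1 h2 i genh1 by (auto simp: Pi_iff)
      have comb3: "int_comb G I h3 w = h1 i [^] w i \<otimes> int_comb G (I - {i}) h2 w" for w
        unfolding int_comb_remove [OF fin i h3]
        using int_comb_cong [of G h2 "I - {i}" h3 w w] h2
        by (auto simp: h3_def comm_group_axioms)
      have rel3: "int_comb G I h3 w = \<one> \<longleftrightarrow> e dvd w i \<and> (\<forall>j\<in>I - {i}. d j dvd w j)" for w
      proof
        assume *: "int_comb G I h3 w = \<one>"
        \<comment> \<open>Rewriting the part without \<open>i\<close> in terms of \<open>h1\<close> gives a relation between the \<open>h1 j\<close>.\<close>
        have "int_comb G (I - {i}) h2 w \<in> generate G (h1 ` (I - {i}))"
          using generate_eq_int_comb [OF _ h2] fin gen2 by auto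
        then obtain u where u: "int_comb G (I - {i}) h2 w = int_comb G (I - {i}) h1 u"
          using generate_eq_int_comb [OF _ I'(2)] fin by auto
        have "int_comb G I h1 (u(i := w i)) = h1 i [^] w i \<otimes> int_comb G (I - {i}) h1 u"
          unfolding int_comb_remove [OF fin i h1]
          using int_comb_cong [of G h1 "I - {i}" h1 "u(i := w i)" u] I'(2)
          by (auto simp: comm_group_axioms)
        then have "e dvd w i"
          using dvd1 [of "u(i := w i)"] * comb3 u by simp
        moreover from this have "int_comb G (I - {i}) h2 w = \<one>"
          using * comb3 [of w] tors_mult h2 by (auto elim!: dvdE)
        ultimately show "e dvd w i \<and> (\<forall>j\<in>I - {i}. d j dvd w j)"
          using rel2 by simp
      next
        assume "e dvd w i \<and> (\<forall>j\<in>I - {i}. d j dvd w j)"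
        then show "int_comb G I h3 w = \<one>"
          using comb3 [of w] rel2 [of w] tors_mult by (auto elim!: dvdE)
      qed
      show ?thesis
        by (rule exI [of _ h3], rule exI [of _ "d(i := e)"]) (use h3 gen3 rel3 i in auto)
    qed
  qed
  then show ?thesis
    using that by blast
qed

end

section \<open>Projectivity, characters and quotients\<close>

lemma comm_group_is_group: "comm_group G \<Longrightarrow> group G"
  by (simp add: comm_group_def)

context comm_group
begin

text \<open>
  A group given by generators and relations maps wherever the relations hold; for cyclic
  generators this only concerns the order of each image separately.
\<close>

lemma hom_from_cyclic_generators:
  assumes "finite I" "h \<in> I \<rightarrow> carrier G" "generate G (h ` I) = carrier G"
    and dvd: "\<And>v i. int_comb G I h v = \<one> \<Longrightarrow> i \<in> I \<Longrightarrow> d i dvd v i"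
    and "comm_group E" "a \<in> I \<rightarrow> carrier E"
    and ord: "\<And>i. i \<in> I \<Longrightarrow> a i [^]\<^bsub>E\<^esub> d i = \<one>\<^bsub>E\<^esub>"
  obtains s where "s \<in> hom G E" "\<And>v. s (int_comb G I h v) = int_comb E I a v"
proof -
  interpret E: comm_group E by fact
  have kill: "int_comb E I a v = \<one>\<^bsub>E\<^esub>" if "int_comb G I h v = \<one>" for v
    unfolding int_comb_def
  proof (rule E.finprod_one_eqI)
    fix i assume i: "i \<in> I"
    from dvd [OF that i] obtain k where "v i = d i * k"
      by blast
    then show "a i [^]\<^bsub>E\<^esub> v i = \<one>\<^bsub>E\<^esub>"
      using E.int_pow_pow [of "a i" "d i" k] ord [OF i] i assms(6)
      by (auto simp: Pi_iff E.int_pow_one)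
  qed
  have well: "int_comb E I a v = int_comb E I a w" if "int_comb G I h v = int_comb G I h w" for v w
  proof -
    have "int_comb G I h (\<lambda>i. v i + - w i) = \<one>"
      using assms(2) that by (simp only: int_comb_add int_comb_uminus) simp
    then have "int_comb E I a (\<lambda>i. v i + - w i) = \<one>\<^bsub>E\<^esub>"
      by (rule kill)
    then have "int_comb E I a v \<otimes>\<^bsub>E\<^esub> inv\<^bsub>E\<^esub> int_comb E I a w = \<one>\<^bsub>E\<^esub>"
      using assms(6) by (simp only: E.int_comb_add E.int_comb_uminus)
    then show ?thesis
      using assms(6) by (metis E.int_comb_closed E.inv_closed E.inv_equality E.inv_inv)
  qed
  define s where "s x = int_comb E I a (SOME v. int_comb G I h v = x)" for x
  have s: "s (int_comb G I h v) = int_comb E I a v" for v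
    unfolding s_def by (rule well) (rule someI [of _ v], simp)
  have "s \<in> hom G E"
  proof (rule homI)
    fix x assume "x \<in> carrier G"
    show "s x \<in> carrier E"
      unfolding s_def using assms(6) by simp
  next
    fix x y assume "x \<in> carrier G" "y \<in> carrier G"
    then obtain v w where "x = int_comb G I h v" "y = int_comb G I h w"
      using generate_eq_int_comb [OF assms(1,2)] assms(3) by auto
    then show "s (x \<otimes> y) = s x \<otimes>\<^bsub>E\<^esub> s y"
      using assms(2,6) by (simp add: s E.int_comb_add flip: int_comb_add)
  qed
  with s show ?thesis
    using that by blast
qed

lemma finitely_generated_decomposition:
  assumes "finitely_generated G"
  obtains I :: "'a set" and h d where "finite I" "h \<in> I \<rightarrow> carrier G"
    "generate G (h ` I) = carrier G"
    "\<And>v. int_comb G I h v = \<one> \<longleftrightarrow> (\<forall>i\<in>I. d i dvd v i)"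
proof -
  obtain S where S: "finite S" "S \<subseteq> carrier G" "generate G S = carrier G"
    using assms unfolding finitely_generated_def by blast
  show ?thesis
  proof (rule cyclic_decomposition [OF S(1), of id])
    show "id \<in> S \<rightarrow> carrier G"
      using S(2) by auto
  qed (use that S in simp)
qed

text \<open>
  If \<open>a\<close> and \<open>b\<close> are the images of \<open>x\<close> and \<open>y\<close> under an endomorphism \<open>\<sigma>\<close>, this says that
  \<open>x \<mapsto> x \<otimes> inv (\<sigma> x)\<close> is again an endomorphism. When \<open>\<sigma>\<close> is a projection followed by a section of it,
  this is the complementary projection, onto the kernel.
\<close>

lemma defect_mult:
  assumes "x \<in> carrier G" "y \<in> carrier G" "a \<in> carrier G" "b \<in> carrier G"
  shows "(x \<otimes> y) \<otimes> inv (a \<otimes> b) = (x \<otimes> inv a) \<otimes> (y \<otimes> inv b)"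
  using assms by (simp add: inv_mult m_ac)

text \<open>
  Finitely generated torsion-free groups are projective: a cyclic generator has infinite order
  unless it is trivial, so arbitrary preimages of the nontrivial generators define a section.
\<close>

theorem torsion_free_section:
  assumes "finitely_generated G" "torsion_free G" "comm_group E" "p \<in> hom E G"
    and surj: "p ` carrier E = carrier G"
  obtains s where "s \<in> hom G E" "\<And>x. x \<in> carrier G \<Longrightarrow> p (s x) = x"
proof -
  interpret E: comm_group E by fact
  obtain I :: "'a set" and h d where I: "finite I" and h: "h \<in> I \<rightarrow> carrier G"
    and gen: "generate G (h ` I) = carrier G"
    and rel: "\<And>v. int_comb G I h v = \<one> \<longleftrightarrow> (\<forall>i\<in>I. d i dvd v i)"
    using finitely_generated_decomposition [OF assms(1)] by blast
  have ord: "h i [^] d i = \<one>" if "i \<in> I" for i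
    using rel [of "\<lambda>j. if j = i then d i else 0"] that
      int_comb_single [OF I that h, of "\<lambda>j. if j = i then d i else 0"] by auto
  \<comment> \<open>A trivial generator has order 1, hence it must be lifted to the neutral element.\<close>
  define a where
    "a i = (if h i = \<one> then \<one>\<^bsub>E\<^esub> else SOME z. z \<in> carrier E \<and> p z = h i)" for i
  have a: "a i \<in> carrier E \<and> p (a i) = h i" if "i \<in> I" for i
  proof (cases "h i = \<one>")
    case True
    then show ?thesis
      using hom_one [OF assms(4)] by (simp add: a_def E.is_group is_group)
  next
    case False
    have "\<exists>z. z \<in> carrier E \<and> p z = h i"
      using surj h that by (metis PiE imageE)
    from someI_ex [OF this] show ?thesis
      using False by (simp add: a_def)
  qed
  have "a i [^]\<^bsub>E\<^esub> d i = \<one>\<^bsub>E\<^esub>" if "i \<in> I" for i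
    using assms(2) ord [OF that] h that unfolding torsion_free_def a_def
    by (cases "d i = 0") (auto simp: E.int_pow_one Pi_iff)
  then obtain s where s: "s \<in> hom G E" "\<And>v. s (int_comb G I h v) = int_comb E I a v"
    using hom_from_cyclic_generators [OF I h gen _ assms(3), of d a] rel a by blast
  have "p (s x) = x" if "x \<in> carrier G" for x
  proof -
    have "x \<in> range (int_comb G I h)"
      using that gen generate_eq_int_comb [OF I h] by simp
    then obtain v where v: "x = int_comb G I h v"
      by auto
    have "p (s x) = int_comb G I (\<lambda>i. p (a i)) v"
      unfolding v s(2) using a by (intro E.hom_int_comb [OF assms(4) comm_group_axioms]) auto
    also have "\<dots> = x"
      unfolding v by (rule int_comb_cong [OF comm_group_axioms h]) (use a in auto)
    finally show ?thesis .
  qed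
  with s(1) show ?thesis
    using that by blast
qed

text \<open>
  An element other than \<open>\<one>\<close> has some coordinate \<open>v i\<close> with respect to cyclic generators that is not
  divisible by the order \<open>m\<close> of the \<open>i\<close>-th generator; reading off this coordinate modulo \<open>m\<close> is
  the character. The target is \<open>\<int>\<close> itself when the order is infinite, i.e. \<open>m = 0\<close>.
\<close>

theorem separating_character:
  assumes "finitely_generated G" "x \<in> carrier G" "x \<noteq> \<one>"
  obtains m \<chi> where "\<chi> \<in> hom G (integer_mod_group m)" "\<chi> x \<noteq> 0"
proof -
  obtain I :: "'a set" and h d where I: "finite I" and h: "h \<in> I \<rightarrow> carrier G"
    and gen: "generate G (h ` I) = carrier G"
    and rel: "\<And>v. int_comb G I h v = \<one> \<longleftrightarrow> (\<forall>i\<in>I. d i dvd v i)"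
    using finitely_generated_decomposition [OF assms(1)] by blast
  have "x \<in> range (int_comb G I h)"
    using assms(2) gen generate_eq_int_comb [OF I h] by simp
  then obtain v where v: "x = int_comb G I h v"
    by auto
  obtain i where i: "i \<in> I" "\<not> d i dvd v i"
    using rel [of v] v assms(3) by auto
  define m where "m = nat \<bar>d i\<bar>"
  have mod_m: "int m dvd k \<longleftrightarrow> d i dvd k" for k
    by (simp add: m_def)
  \<comment> \<open>\<open>1 mod m\<close> rather than \<open>1\<close>, since for \<open>m = 1\<close> the only element of the target is \<open>0\<close>\<close>
  define a where "a j = (if j = i then 1 mod int m else 0)" for j
  have a: "a \<in> I \<rightarrow> carrier (integer_mod_group m)"
    by (auto simp: a_def carrier_integer_mod_group)
  have a_pow: "a j [^]\<^bsub>integer_mod_group m\<^esub> k = (if j = i then k mod int m else 0)" for j k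
    by (simp add: a_def int_pow_integer_mod_group mod_mult_right_eq)
  obtain \<chi> where \<chi>: "\<chi> \<in> hom G (integer_mod_group m)"
    "\<And>v. \<chi> (int_comb G I h v) = int_comb (integer_mod_group m) I a v"
  proof (rule hom_from_cyclic_generators [OF I h gen _ _ a, of d])
    show "a j [^]\<^bsub>integer_mod_group m\<^esub> d j = \<one>\<^bsub>integer_mod_group m\<^esub>" if "j \<in> I" for j
      using mod_m [of "d i"] by (auto simp: a_pow mod_eq_0_iff_dvd)
  qed (use rel in auto)
  have "int_comb (integer_mod_group m) I a v
      = finprod (integer_mod_group m) (\<lambda>j. if j = i then a j [^]\<^bsub>integer_mod_group m\<^esub> v j
          else \<one>\<^bsub>integer_mod_group m\<^esub>) I"
    unfolding int_comb_def
    by (rule arg_cong [of _ _ "\<lambda>f. finprod _ f I"]) (auto simp: a_pow fun_eq_iff)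
  also have "\<dots> = a i [^]\<^bsub>integer_mod_group m\<^esub> v i"
    by (rule comm_monoid.finprod_singleton_swap)
       (use i I a in \<open>auto intro: comm_group.axioms simp: Pi_iff group.int_pow_closed\<close>)
  finally have "\<chi> x \<noteq> 0"
    using mod_m i v \<chi>(2) by (simp add: a_pow mod_eq_0_iff_dvd)
  with \<chi>(1) show ?thesis
    using that by blast
qed

lemma torsion_free_Mod_iff:
  assumes "subgroup N G"
  shows "torsion_free (G Mod N) \<longleftrightarrow>
    (\<forall>y\<in>carrier G. \<forall>n::int. n \<noteq> 0 \<longrightarrow> y [^] n \<in> N \<longrightarrow> y \<in> N)"
proof -
  interpret N: normal N G
    by (rule subgroup_imp_normal [OF assms])
  have eq_one: "N #> y = N \<longleftrightarrow> y \<in> N" if "y \<in> carrier G" for y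
    using coset_join1 [OF _ that assms] coset_join2 [OF that assms] by blast
  have pow: "(N #> y) [^]\<^bsub>G Mod N\<^esub> n = N #> (y [^] n)" if "y \<in> carrier G" for y and n :: int
    using hom_int_pow [OF N.r_coset_hom_Mod that] N.factorgroup_is_group by simp
  show ?thesis
    unfolding torsion_free_def carrier_FactGroup
    by (auto simp: pow eq_one)
qed

lemma trivial_Mod_iff:
  assumes "subgroup N G"
  shows "trivial_group (G Mod N) \<longleftrightarrow> carrier G \<subseteq> N"
proof -
  interpret N: normal N G
    by (rule subgroup_imp_normal [OF assms])
  have "trivial_group (G Mod N) \<longleftrightarrow> (\<forall>x\<in>carrier G. N #> x = N)"
    using N.factorgroup_is_group one_closed unfolding trivial_group_def carrier_FactGroup by auto
  also have "\<dots> \<longleftrightarrow> carrier G \<subseteq> N"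
    using coset_join1 [OF _ _ assms] coset_join2 [OF _ assms] by blast
  finally show ?thesis .
qed

lemma finitely_generated_Mod:
  assumes "finitely_generated G" "subgroup N G"
  shows "finitely_generated (G Mod N)"
proof -
  interpret N: normal N G
    by (rule subgroup_imp_normal [OF assms(2)])
  interpret p: group_hom G "G Mod N" "\<lambda>y. N #> y"
    by (simp add: group_hom_def group_hom_axioms_def is_group N.r_coset_hom_Mod
        N.factorgroup_is_group)
  obtain S where S: "finite S" "S \<subseteq> carrier G" "generate G S = carrier G"
    using assms unfolding finitely_generated_def by blast
  show ?thesis
    unfolding finitely_generated_def
    by (rule exI [of _ "(\<lambda>y. N #> y) ` S"])
       (use S p.generate_img [OF S(2)] in \<open>auto simp: carrier_FactGroup\<close>)
qed

end

section \<open>Ext and torsion\<close>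

lemma hom_group_comm_group:
  assumes "group G" "comm_group A"
  shows "comm_group (hom_group G A)"
proof -
  interpret G: group G by fact
  interpret A: comm_group A by fact
  show ?thesis
  proof (rule comm_groupI)
    fix \<phi> assume \<phi>: "\<phi> \<in> carrier (hom_group G A)"
    define \<psi> where "\<psi> = (\<lambda>x\<in>carrier G. inv\<^bsub>A\<^esub> \<phi> x)"
    have "\<psi> \<in> carrier (hom_group G A)"
      using \<phi> unfolding hom_group_def \<psi>_def
      by (auto simp: hom_def Pi_iff A.inv_mult)
    moreover have "\<psi> \<otimes>\<^bsub>hom_group G A\<^esub> \<phi> = \<one>\<^bsub>hom_group G A\<^esub>"
      using \<phi> unfolding hom_group_def \<psi>_def by (auto simp: hom_def Pi_iff fun_eq_iff)
    ultimately show "\<exists>\<psi>\<in>carrier (hom_group G A). \<psi> \<otimes>\<^bsub>hom_group G A\<^esub> \<phi> = \<one>\<^bsub>hom_group G A\<^esub>"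
      by blast
  qed (auto simp: hom_group_def hom_def Pi_iff fun_eq_iff extensional_def A.m_ac)
qed

lemma free_cover_eq_int_comb:
  assumes "comm_group C" "finite K" "Poly_Mapping.keys v \<subseteq> K" "K \<subseteq> carrier C"
  shows "free_cover C v = int_comb C K id (Poly_Mapping.lookup v)"
proof -
  interpret comm_group C by fact
  show ?thesis
    unfolding free_cover_def int_comb_def
    by (rule finprod_mono_neutral_cong_left) (use assms in \<open>auto simp: in_keys_iff\<close>)
qed

lemma free_cover_hom:
  assumes "comm_group C"
  shows "free_cover C \<in> hom (free_Abelian_group (carrier C)) C"
proof -
  interpret comm_group C by fact
  show ?thesis
  proof (rule homI)
    fix v assume "v \<in> carrier (free_Abelian_group (carrier C))"
    then show "free_cover C v \<in> carrier C"
      by (auto simp: free_cover_def intro!: finprod_closed)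
  next
    fix v w assume vw: "v \<in> carrier (free_Abelian_group (carrier C))"
      "w \<in> carrier (free_Abelian_group (carrier C))"
    define K where "K = Poly_Mapping.keys v \<union> Poly_Mapping.keys w"
    have K: "finite K" "K \<subseteq> carrier C"
      using vw by (auto simp: K_def)
    have "free_cover C (v + w) = int_comb C K id (Poly_Mapping.lookup (v + w))"
      using keys_add [of v w] K by (intro free_cover_eq_int_comb assms) (auto simp: K_def)
    also have "\<dots> = int_comb C K id (Poly_Mapping.lookup v)
        \<otimes>\<^bsub>C\<^esub> int_comb C K id (Poly_Mapping.lookup w)"
      using K by (subst int_comb_add [symmetric])
         (auto simp: lookup_add fun_eq_iff intro!: arg_cong [of _ _ "int_comb C K id"])
    also have "\<dots> = free_cover C v \<otimes>\<^bsub>C\<^esub> free_cover C w"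
      using K by (subst (1 2) free_cover_eq_int_comb [OF assms, of K]) (auto simp: K_def)
    finally show "free_cover C (v \<otimes>\<^bsub>free_Abelian_group (carrier C)\<^esub> w)
        = free_cover C v \<otimes>\<^bsub>C\<^esub> free_cover C w"
      by simp
  qed
qed

lemma free_cover_frag_of:
  assumes "comm_group C" "x \<in> carrier C"
  shows "free_cover C (frag_of x) = x"
proof -
  interpret comm_group C by fact
  show ?thesis
    using int_comb_single [of "{x}" x id "Poly_Mapping.lookup (frag_of x)"] assms(2)
    by (subst free_cover_eq_int_comb [OF assms(1), of "{x}"]) auto
qed

lemma free_cover_surj:
  assumes "comm_group C"
  shows "free_cover C ` carrier (free_Abelian_group (carrier C)) = carrier C"
proof -
  have "x \<in> free_cover C ` carrier (free_Abelian_group (carrier C))" if "x \<in> carrier C" for x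
    using free_cover_frag_of [OF assms that] that by (intro image_eqI [of _ _ "frag_of x"]) auto
  then show ?thesis
    using free_cover_hom [OF assms] by (auto simp: hom_def)
qed

lemma subgroup_free_relations:
  assumes "comm_group C"
  shows "subgroup (free_relations C) (free_Abelian_group (carrier C))"
proof -
  interpret group_hom "free_Abelian_group (carrier C)" C "free_cover C"
    using free_cover_hom [OF assms] assms
    by (simp add: group_hom_def group_hom_axioms_def comm_group_is_group)
  show ?thesis
    unfolding free_relations_def by (rule subgroup_kernel)
qed

text \<open>
  The concrete meaning of a vanishing \<open>Ext\<close>: homomorphisms on the relations of the canonical free
  resolution extend to the free group.
\<close>

lemma trivial_Ext1_iff:
  fixes C :: "('a, 'm) monoid_scheme" and A :: "('b, 'n) monoid_scheme"
  assumes "comm_group C" "comm_group A"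
  defines "F \<equiv> free_Abelian_group (carrier C)" and "R \<equiv> free_relations C"
  shows "trivial_group (Ext1 C A) \<longleftrightarrow>
    (\<forall>\<psi>\<in>hom (F\<lparr>carrier := R\<rparr>) A. \<exists>\<phi>\<in>hom F A. \<forall>r\<in>R. \<phi> r = \<psi> r)"
proof -
  let ?HF = "hom_group F A" and ?HR = "hom_group (F\<lparr>carrier := R\<rparr>) A"
  let ?res = "\<lambda>\<phi>. restrict \<phi> R"
  have F: "group F"
    by (simp add: F_def)
  have R: "subgroup R F"
    unfolding F_def R_def by (rule subgroup_free_relations [OF assms(1)])
  then have FR: "group (F\<lparr>carrier := R\<rparr>)"
    using F by (rule subgroup.subgroup_is_group)
  have RF: "R \<subseteq> carrier F"
    using R by (rule subgroup.subset)
  interpret HF: comm_group ?HF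
    by (rule hom_group_comm_group [OF F assms(2)])
  interpret HR: comm_group ?HR
    by (rule hom_group_comm_group [OF FR assms(2)])
  have "?res \<in> hom ?HF ?HR"
    using RF subgroup.m_closed [OF R]
    by (intro homI) (auto simp: hom_group_def hom_def Pi_iff subset_iff fun_eq_iff)
  then interpret res: group_hom ?HF ?HR ?res
    by unfold_locales
  let ?N = "?res ` carrier ?HF"
  have N: "subgroup ?N ?HR"
    by (rule res.img_is_subgroup)
  have Ext: "Ext1 C A = ?HR Mod ?N"
    by (simp add: Ext1_def Let_def F_def R_def)
  have "trivial_group (?HR Mod ?N) \<longleftrightarrow> carrier ?HR \<subseteq> ?N"
    by (rule HR.trivial_Mod_iff [OF N])
  also have "\<dots> \<longleftrightarrow> (\<forall>\<psi>\<in>hom (F\<lparr>carrier := R\<rparr>) A. \<exists>\<phi>\<in>hom F A. \<forall>r\<in>R. \<phi> r = \<psi> r)"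
  proof (intro iffI subsetI ballI)
    fix \<psi> assume N: "carrier ?HR \<subseteq> ?N" and \<psi>: "\<psi> \<in> hom (F\<lparr>carrier := R\<rparr>) A"
    have "?res \<psi> \<in> carrier ?HR"
      using \<psi> subgroup.m_closed [OF R] by (auto simp: hom_group_def hom_def Pi_iff)
    with N obtain \<phi> where "\<phi> \<in> carrier ?HF" "?res \<psi> = ?res \<phi>"
      by blast
    then show "\<exists>\<phi>\<in>hom F A. \<forall>r\<in>R. \<phi> r = \<psi> r"
      by (intro bexI [of _ \<phi>] ballI) (metis restrict_apply', simp add: hom_group_def)
  next
    fix \<psi>
    assume ext: "\<forall>\<psi>\<in>hom (F\<lparr>carrier := R\<rparr>) A. \<exists>\<phi>\<in>hom F A. \<forall>r\<in>R. \<phi> r = \<psi> r"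
      and \<psi>: "\<psi> \<in> carrier ?HR"
    then obtain \<phi> where \<phi>: "\<phi> \<in> hom F A" "\<And>r. r \<in> R \<Longrightarrow> \<phi> r = \<psi> r"
      unfolding hom_group_def by auto
    have "restrict \<phi> (carrier F) \<in> carrier ?HF"
      using \<phi>(1) F by (auto simp: hom_group_def hom_def Pi_iff group.is_monoid monoid.m_closed)
    moreover have "\<psi> = ?res (restrict \<phi> (carrier F))"
      using \<psi> \<phi>(2) RF by (auto simp: hom_group_def fun_eq_iff extensional_def)
    ultimately show "\<psi> \<in> ?N"
      by blast
  qed
  finally show ?thesis
    by (simp add: Ext)
qed

text \<open>
  A section \<open>s\<close> of the free cover splits the resolution: \<open>v \<mapsto> v - s (free_cover C v)\<close> retracts the
  free group onto the relations, and composing with it extends homomorphisms.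
\<close>

lemma trivial_Ext1_if_torsion_free:
  assumes "comm_group C" "finitely_generated C" "torsion_free C" "comm_group A"
  shows "trivial_group (Ext1 C A)"
proof -
  let ?F = "free_Abelian_group (carrier C)" and ?R = "free_relations C" and ?p = "free_cover C"
  interpret C: comm_group C by fact
  interpret A: comm_group A by fact
  interpret F: comm_group ?F
    by (rule abelian_free_Abelian_group)
  interpret p: group_hom ?F C ?p
    using free_cover_hom [OF assms(1)] by (simp add: group_hom_def group_hom_axioms_def C.is_group)
  obtain s where s: "s \<in> hom C ?F" "\<And>x. x \<in> carrier C \<Longrightarrow> ?p (s x) = x"
    using C.torsion_free_section [OF assms(2,3) abelian_free_Abelian_group
        free_cover_hom [OF assms(1)] free_cover_surj [OF assms(1)]] by blast
  interpret s: group_hom C ?F s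
    using s(1) by (simp add: group_hom_def group_hom_axioms_def C.is_group)
  have FR: "subgroup ?R ?F"
    by (rule subgroup_free_relations [OF assms(1)])
  show ?thesis
    unfolding trivial_Ext1_iff [OF assms(1,4)]
  proof
    fix \<psi> assume \<psi>: "\<psi> \<in> hom (?F\<lparr>carrier := ?R\<rparr>) A"
    define t where "t v = v \<otimes>\<^bsub>?F\<^esub> inv\<^bsub>?F\<^esub> s (?p v)" for v
    have t_in: "t v \<in> ?R" if "v \<in> carrier ?F" for v
      using that unfolding t_def free_relations_def kernel_def
      by (simp del: carrier_free_Abelian_group_iff mult_free_Abelian_group inv_free_Abelian_group
          add: s(2))
    have t_mult: "t (v \<otimes>\<^bsub>?F\<^esub> w) = t v \<otimes>\<^bsub>?F\<^esub> t w" if "v \<in> carrier ?F" "w \<in> carrier ?F" for v w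
      unfolding t_def p.hom_mult [OF that]
        s.hom_mult [OF p.hom_closed [OF that(1)] p.hom_closed [OF that(2)]]
      using that p.hom_closed s.hom_closed by (intro F.defect_mult) blast+
    have "(\<lambda>v. \<psi> (t v)) \<in> hom ?F A"
      using \<psi> t_in by (intro homI)
        (auto simp: t_mult hom_def Pi_iff
          simp del: carrier_free_Abelian_group_iff mult_free_Abelian_group)
    moreover have "t r = r" if "r \<in> ?R" for r
    proof -
      have "r \<in> carrier ?F" "?p r = \<one>\<^bsub>C\<^esub>"
        using that by (auto simp: free_relations_def kernel_def)
      then show ?thesis
        using s.hom_one by (simp add: t_def)
    qed
    ultimately show "\<exists>\<phi>\<in>hom ?F A. \<forall>r\<in>?R. \<phi> r = \<psi> r"
      by (intro bexI) auto
  qed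
qed

text \<open>
  A torsion element \<open>x \<noteq> \<one>\<close> is detected by a character \<open>\<chi>\<close> with values modulo \<open>m\<close>. Lift \<open>\<chi>\<close> to a
  homomorphism \<open>\<phi>\<close> from the free group \<open>F\<close> to \<open>\<int>\<close>. On the relations \<open>\<phi>\<close> takes multiples of \<open>m\<close>, so
  \<open>\<phi> div m\<close> is a homomorphism there. Were it the restriction of some \<open>\<psi>\<close> on \<open>F\<close>, then \<open>\<phi> - m * \<psi>\<close>
  would vanish on the relations and hence on every torsion element of \<open>C\<close>, so \<open>m\<close> would divide
  \<open>\<phi> (frag_of x)\<close>, contradicting \<open>\<chi> x \<noteq> 0\<close>. The case \<open>m = 0\<close> is covered, with \<open>k div 0 = 0\<close>.
\<close>

lemma torsion_free_if_trivial_Ext1: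
  assumes "comm_group C" "finitely_generated C" "trivial_group (Ext1 C integer_group)"
  shows "torsion_free C"
  unfolding torsion_free_def
proof (intro ballI allI impI, rule ccontr)
  fix x and n :: int
  assume x: "x \<in> carrier C" and n: "n \<noteq> 0" and tors: "x [^]\<^bsub>C\<^esub> n = \<one>\<^bsub>C\<^esub>" and "x \<noteq> \<one>\<^bsub>C\<^esub>"
  let ?F = "free_Abelian_group (carrier C)" and ?R = "free_relations C" and ?p = "free_cover C"
  interpret C: comm_group C by fact
  interpret p: group_hom ?F C ?p
    using free_cover_hom [OF assms(1)] by (simp add: group_hom_def group_hom_axioms_def C.is_group)
  obtain m \<chi> where \<chi>: "\<chi> \<in> hom C (integer_mod_group m)" "\<chi> x \<noteq> 0"
    using C.separating_character [OF assms(2) x \<open>x \<noteq> \<one>\<^bsub>C\<^esub>\<close>] by blast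
  interpret \<chi>: group_hom C "integer_mod_group m" \<chi>
    using \<chi>(1) by (simp add: group_hom_def group_hom_axioms_def C.is_group)
  obtain \<phi> where \<phi>: "\<phi> \<in> hom ?F integer_group" and \<phi>_of: "\<And>y. y \<in> carrier C \<Longrightarrow> \<phi> (frag_of y) = \<chi> y"
    using comm_group.free_Abelian_group_universal [OF abelian_integer_group, of \<chi> "carrier C"]
    by auto
  interpret \<phi>: group_hom ?F integer_group \<phi>
    using \<phi> by (simp add: group_hom_def group_hom_axioms_def)
  have \<chi>_mod: "\<chi> y mod int m = \<chi> y" if "y \<in> carrier C" for y
    using \<chi>.hom_closed [OF that] by (auto simp: carrier_integer_mod_group split: if_splits)
  have lift: "\<phi> v mod int m = \<chi> (?p v)" if "v \<in> carrier ?F" for v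
  proof -
    have "Poly_Mapping.keys v \<subseteq> carrier C"
      using that by simp
    then show ?thesis
    proof (rule free_Abelian_group_induct)
      show "\<phi> 0 mod int m = \<chi> (?p 0)"
        using \<phi>.hom_one p.hom_one \<chi>.hom_one by simp
    next
      fix v w
      assume vw: "Poly_Mapping.keys v \<subseteq> carrier C" "Poly_Mapping.keys w \<subseteq> carrier C"
        and IH: "\<phi> v mod int m = \<chi> (?p v)" "\<phi> w mod int m = \<chi> (?p w)"
      have "v - w = v \<otimes>\<^bsub>?F\<^esub> inv\<^bsub>?F\<^esub> w"
        using vw by simp
      then have "\<phi> (v - w) = \<phi> v - \<phi> w" "?p (v - w) = ?p v \<otimes>\<^bsub>C\<^esub> inv\<^bsub>C\<^esub> ?p w"
        using vw \<phi>.hom_mult [of v "inv\<^bsub>?F\<^esub> w"] p.hom_mult [of v "inv\<^bsub>?F\<^esub> w"]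
          \<phi>.hom_inv [of w] p.hom_inv [of w] by simp_all
      moreover have "?p v \<in> carrier C" "?p w \<in> carrier C"
        using vw p.hom_closed by simp_all
      moreover from this have "\<chi> (inv\<^bsub>C\<^esub> ?p w) = (- \<chi> (?p w)) mod int m"
        using \<chi>.hom_closed \<chi>.hom_inv by simp
      ultimately show "\<phi> (v - w) mod int m = \<chi> (?p (v - w))"
        by (simp add: mod_simps flip: IH)
    next
      fix y assume "y \<in> carrier C"
      then show "\<phi> (frag_of y) mod int m = \<chi> (?p (frag_of y))"
        using \<phi>_of \<chi>_mod free_cover_frag_of [OF assms(1)] by simp
    qed
  qed
  have \<phi>_R: "int m dvd \<phi> r" if "r \<in> ?R" for r
    using that lift [of r] \<chi>.hom_one by (auto simp: free_relations_def kernel_def mod_eq_0_iff_dvd)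
  have RF: "?R \<subseteq> carrier ?F"
    using subgroup_free_relations [OF assms(1)] by (rule subgroup.subset)
  have div_hom: "(\<lambda>r. \<phi> r div int m) \<in> hom (?F\<lparr>carrier := ?R\<rparr>) integer_group"
    using \<phi>_R RF \<phi>.hom_mult by (intro homI) (auto simp: div_plus_div_distrib_dvd_left subset_iff)
  obtain \<psi> where \<psi>: "\<psi> \<in> hom ?F integer_group" "\<And>r. r \<in> ?R \<Longrightarrow> \<psi> r = \<phi> r div int m"
    using bspec [OF iffD1 [OF trivial_Ext1_iff [OF assms(1) abelian_integer_group] assms(3)] div_hom]
    by auto
  interpret \<psi>: group_hom ?F integer_group \<psi>
    using \<psi>(1) by (simp add: group_hom_def group_hom_axioms_def)
  have xF: "frag_of x \<in> carrier ?F"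
    using x by simp
  let ?r = "frag_of x [^]\<^bsub>?F\<^esub> n"
  have "?r \<in> ?R"
    using p.hom_int_pow [OF xF, of n] x tors group.int_pow_closed [OF group_free_Abelian_group xF]
    by (simp add: free_relations_def kernel_def free_cover_frag_of [OF assms(1)])
  then have "\<phi> ?r = int m * \<psi> ?r"
    using \<psi>(2) \<phi>_R by simp
  then have "n * \<phi> (frag_of x) = n * (int m * \<psi> (frag_of x))"
    using \<phi>.hom_int_pow [OF xF, of n] \<psi>.hom_int_pow [OF xF, of n] by simp
  then have "\<phi> (frag_of x) = int m * \<psi> (frag_of x)"
    using n by simp
  then have "\<chi> x = 0"
    using lift [OF xF] x by (simp add: free_cover_frag_of [OF assms(1)])
  with \<chi>(2) show False
    by simp
qed

section \<open>Integer programming duality\<close>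

lemma SUP_of_int_eq_PInf:
  assumes "\<And>k. \<exists>x\<in>S. k \<le> g x"
  shows "(SUP x\<in>S. ereal (of_int (g x))) = \<infinity>"
proof (rule SUP_PInfty)
  fix n :: nat
  obtain x where x: "x \<in> S" "int n \<le> g x"
    using assms by blast
  have "real_of_int (int n) \<le> real_of_int (g x)"
    using x(2) by (simp only: of_int_le_iff)
  then show "\<exists>x\<in>S. ereal (real n) \<le> ereal (of_int (g x))"
    using x(1) by (intro bexI [of _ x]) auto
qed

lemma INF_of_int_eq_MInf:
  assumes "\<And>k. \<exists>x\<in>S. g x \<le> k"
  shows "(INF x\<in>S. ereal (of_int (g x))) = - \<infinity>"
proof -
  have "(SUP x\<in>S. ereal (of_int (- g x))) = \<infinity>"
  proof (rule SUP_of_int_eq_PInf)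
    fix k
    obtain x where "x \<in> S" "g x \<le> - k"
      using assms by blast
    then show "\<exists>x\<in>S. k \<le> - g x"
      by (intro bexI [of _ x]) auto
  qed
  then have "(SUP x\<in>S. - ereal (of_int (g x))) = \<infinity>"
    by simp
  then have "- (INF x\<in>S. ereal (of_int (g x))) = \<infinity>"
    by (simp only: ereal_SUP_uminus_eq)
  then show ?thesis
    by (simp add: ereal_uminus_eq_reorder)
qed

lemma ex_multiple_below:
  fixes a d m :: int
  assumes "d \<noteq> 0"
  obtains t where "a + t * d \<le> m"
proof -
  define t where "t = - sgn d * (\<bar>m\<bar> + \<bar>a\<bar>)"
  define K where "K = (\<bar>m\<bar> + \<bar>a\<bar>) * \<bar>d\<bar>"
  have "t * d = - K"
    by (simp add: t_def K_def abs_sgn algebra_simps)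
  moreover have "(\<bar>m\<bar> + \<bar>a\<bar>) * 1 \<le> K"
    unfolding K_def using assms by (intro mult_left_mono) auto
  moreover have "a - (\<bar>m\<bar> + \<bar>a\<bar>) \<le> m"
    by linarith
  ultimately have "a + t * d \<le> m"
    by simp
  then show ?thesis
    using that by blast
qed

lemma dual_feasibleD:
  assumes "l \<in> dual_feasible XZ YZ f c"
  shows "l \<in> hom YZ integer_group" "\<And>x. x \<in> carrier XZ \<Longrightarrow> c x = - l (f x)"
  using assms by (auto simp: dual_feasible_def add_eq_0_iff)

lemma comm_group_coker:
  assumes "comm_group YZ" "f \<in> hom XZ YZ" "group XZ"
  shows "subgroup (f ` carrier XZ) YZ" "comm_group (coker XZ YZ f)"
proof -
  interpret Y: comm_group YZ by fact
  interpret f: group_hom XZ YZ f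
    using assms by (simp add: group_hom_def group_hom_axioms_def Y.is_group)
  show "subgroup (f ` carrier XZ) YZ"
    by (rule f.img_is_subgroup)
  then show "comm_group (coker XZ YZ f)"
    unfolding coker_def by (rule Y.abelian_FactGroup)
qed

text \<open>
  Suppose \<open>b\<close> is not in the image of \<open>f\<close> but a nonzero multiple of it is. For \<open>c = 0\<close> the dual is
  feasible, and every dual feasible \<open>l\<close> vanishes on the image and hence at \<open>b\<close>: the dual value is
  \<open>0\<close> although the primal is infeasible.
\<close>

lemma torsion_free_coker_if_duality:
  assumes "comm_group XZ" "comm_group YZ" "f \<in> hom XZ YZ"
    and duality: "\<And>c b. c \<in> hom XZ integer_group \<Longrightarrow> b \<in> carrier YZ \<Longrightarrow>
      dual_feasible XZ YZ f c \<noteq> {} \<Longrightarrow> dual_value XZ YZ f b c = primal_value XZ f b c"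
  shows "torsion_free (coker XZ YZ f)"
proof -
  interpret X: comm_group XZ by fact
  interpret Y: comm_group YZ by fact
  have "b \<in> f ` carrier XZ"
    if b: "b \<in> carrier YZ" and n: "n \<noteq> 0" and tors: "b [^]\<^bsub>YZ\<^esub> n \<in> f ` carrier XZ"
    for b and n :: int
  proof (rule ccontr)
    assume b_notin: "b \<notin> f ` carrier XZ"
    let ?c = "\<lambda>_. 0 :: int"
    have c: "?c \<in> hom XZ integer_group" and l: "(\<lambda>_. 0) \<in> dual_feasible XZ YZ f ?c"
      by (auto simp: dual_feasible_def hom_def)
    have "l b = 0" if "l \<in> dual_feasible XZ YZ f ?c" for l
    proof -
      have "l (b [^]\<^bsub>YZ\<^esub> n) = n * l b"
        using hom_int_pow [OF dual_feasibleD(1) [OF that] b Y.is_group group_integer_group] by simp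
      moreover have "l (b [^]\<^bsub>YZ\<^esub> n) = 0"
        using tors dual_feasibleD(2) [OF that] by auto
      ultimately show ?thesis
        using n by simp
    qed
    then have "dual_value XZ YZ f b ?c \<le> 0"
      unfolding dual_value_def
      by (intro SUP_least) (metis minus_zero of_int_0 order_refl zero_ereal_def)
    moreover have "primal_feasible XZ f b = {}"
      using b_notin by (auto simp: primal_feasible_def)
    then have "primal_value XZ f b ?c = \<infinity>"
      by (simp add: primal_value_def top_ereal_def)
    ultimately show False
      using duality [OF c b] l by fastforce
  qed
  then show ?thesis
    unfolding coker_def
    using Y.torsion_free_Mod_iff [OF comm_group_coker(1) [OF assms(2,3) X.is_group]] by blast
qed

text \<open>
  A functional \<open>c\<close> that vanishes on the kernel of \<open>f\<close> descends to the image. A torsion-free cokernel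
  makes the image a direct summand of \<open>YZ\<close>, so the functional extends to all of \<open>YZ\<close>.
\<close>

lemma dual_feasible_if_zero_on_kernel:
  assumes "comm_group XZ" "comm_group YZ" "finitely_generated YZ" "f \<in> hom XZ YZ"
    and tf: "torsion_free (coker XZ YZ f)"
    and c: "c \<in> hom XZ integer_group"
    and zero: "\<And>x. x \<in> carrier XZ \<Longrightarrow> f x = \<one>\<^bsub>YZ\<^esub> \<Longrightarrow> c x = 0"
  shows "dual_feasible XZ YZ f c \<noteq> {}"
proof -
  interpret X: comm_group XZ by fact
  interpret Y: comm_group YZ by fact
  interpret f: group_hom XZ YZ f
    using assms(4) by (simp add: group_hom_def group_hom_axioms_def X.is_group Y.is_group)
  interpret c: group_hom XZ integer_group c
    using c by (simp add: group_hom_def group_hom_axioms_def X.is_group)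
  let ?N = "f ` carrier XZ" and ?C = "coker XZ YZ f"
  have N: "subgroup ?N YZ" and C: "comm_group ?C"
    using comm_group_coker [OF assms(2,4) X.is_group] by auto
  interpret N: normal ?N YZ
    by (rule Y.subgroup_imp_normal [OF N])
  interpret C: comm_group ?C
    by (rule C)
  let ?p = "\<lambda>y. ?N #>\<^bsub>YZ\<^esub> y"
  have p: "?p \<in> hom YZ ?C"
    unfolding coker_def by (rule N.r_coset_hom_Mod)
  have fgC: "finitely_generated ?C"
    unfolding coker_def by (rule Y.finitely_generated_Mod [OF assms(3) N])
  have surj: "?p ` carrier YZ = carrier ?C"
    by (simp add: coker_def carrier_FactGroup)
  obtain s where s: "s \<in> hom ?C YZ" "\<And>x. x \<in> carrier ?C \<Longrightarrow> ?p (s x) = x"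
    using C.torsion_free_section [OF fgC tf assms(2) p surj] by blast
  interpret p: group_hom YZ ?C ?p
    using p by (simp add: group_hom_def group_hom_axioms_def Y.is_group C.is_group)
  interpret s: group_hom ?C YZ s
    using s(1) by (simp add: group_hom_def group_hom_axioms_def Y.is_group C.is_group)
  \<comment> \<open>the projection onto the image along the complement given by the section\<close>
  define r where "r y = y \<otimes>\<^bsub>YZ\<^esub> inv\<^bsub>YZ\<^esub> s (?p y)" for y
  have one_C: "\<one>\<^bsub>?C\<^esub> = ?N"
    by (simp add: coker_def)
  have r_N: "r y \<in> ?N" if "y \<in> carrier YZ" for y
  proof (rule Y.coset_join1 [OF _ _ N])
    show "r y \<in> carrier YZ"
      using that by (simp add: r_def)
    have "?p (r y) = \<one>\<^bsub>?C\<^esub>"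
      using that unfolding r_def by (simp add: s(2))
    then show "?p (r y) = ?N"
      by (simp add: one_C)
  qed
  have r_mult: "r (y \<otimes>\<^bsub>YZ\<^esub> z) = r y \<otimes>\<^bsub>YZ\<^esub> r z" if "y \<in> carrier YZ" "z \<in> carrier YZ" for y z
    using that unfolding r_def by (simp add: Y.defect_mult)
  have r_f: "r (f x) = f x" if "x \<in> carrier XZ" for x
  proof -
    have "?p (f x) = \<one>\<^bsub>?C\<^esub>"
      using that Y.coset_join2 [OF _ N] by (simp add: one_C)
    then show ?thesis
      using that by (simp add: r_def)
  qed
  \<comment> \<open>the functional that \<open>c\<close> induces on the image\<close>
  define g where "g y = c (SOME x. x \<in> carrier XZ \<and> f x = y)" for y
  have g_f: "g (f x) = c x" if "x \<in> carrier XZ" for x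
  proof -
    define z where "z = (SOME z. z \<in> carrier XZ \<and> f z = f x)"
    have z: "z \<in> carrier XZ" "f z = f x"
      using someI [of "\<lambda>z. z \<in> carrier XZ \<and> f z = f x" x] that by (simp_all add: z_def)
    have "c (z \<otimes>\<^bsub>XZ\<^esub> inv\<^bsub>XZ\<^esub> x) = 0"
      using that z by (intro zero) auto
    then show ?thesis
      using that z by (simp add: g_def flip: z_def)
  qed
  have g_mult: "g (y \<otimes>\<^bsub>YZ\<^esub> z) = g y + g z" if y: "y \<in> ?N" and z: "z \<in> ?N" for y z
  proof -
    obtain u where u: "y = f u" "u \<in> carrier XZ"
      using y by blast
    obtain v where v: "z = f v" "v \<in> carrier XZ"
      using z by blast
    have "g (y \<otimes>\<^bsub>YZ\<^esub> z) = g (f (u \<otimes>\<^bsub>XZ\<^esub> v))"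
      using u v by simp
    also have "\<dots> = c u + c v"
      using u v by (subst g_f) auto
    finally show ?thesis
      using u v by (simp only: g_f)
  qed
  have "(\<lambda>y. - g (r y)) \<in> hom YZ integer_group"
    by (intro homI) (auto simp: r_mult g_mult r_N)
  then have "(\<lambda>y. - g (r y)) \<in> dual_feasible XZ YZ f c"
    by (simp add: dual_feasible_def r_f g_f)
  then show ?thesis
    by blast
qed

text \<open>
  The group embeds into a free group by a section of its free cover, and the coordinates of the
  free group separate points.
\<close>

lemma (in comm_group) torsion_free_separating_hom:
  assumes "finitely_generated G" "torsion_free G" "x \<in> carrier G" "x \<noteq> \<one>"
  obtains h where "h \<in> hom G integer_group" "h x \<noteq> 0"
proof -
  let ?F = "free_Abelian_group (carrier G)"
  obtain s where s: "s \<in> hom G ?F" "\<And>y. y \<in> carrier G \<Longrightarrow> free_cover G (s y) = y"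
    using torsion_free_section [OF assms(1,2) abelian_free_Abelian_group
        free_cover_hom [OF comm_group_axioms] free_cover_surj [OF comm_group_axioms]] by blast
  have "s x \<noteq> 0"
    using s(2) [OF assms(3)] assms(4) by (auto simp: free_cover_def)
  then obtain k where k: "Poly_Mapping.lookup (s x) k \<noteq> 0"
    by (metis poly_mapping_eqI lookup_zero)
  have "(\<lambda>y. Poly_Mapping.lookup (s y) k) \<in> hom G integer_group"
    using hom_mult [OF s(1)] by (intro homI) (auto simp: lookup_add)
  with k show ?thesis
    using that by blast
qed

text \<open>
  If both programs are feasible, the constraints determine both objectives: \<open>c x = - l b\<close> for all
  feasible \<open>x\<close> and \<open>l\<close>. If only the primal is feasible, \<open>c\<close> does not vanish on the kernel of \<open>f\<close>,
  and moving along the kernel makes the primal unbounded. If only the dual is feasible, \<open>b\<close> is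
  nonzero in the cokernel, hence some functional on the cokernel does not vanish at \<open>b\<close>, and adding
  multiples of it makes the dual unbounded.
\<close>

lemma duality_if_torsion_free_coker:
  assumes "comm_group XZ" "comm_group YZ" "finitely_generated YZ" "f \<in> hom XZ YZ"
    and tf: "torsion_free (coker XZ YZ f)"
    and c: "c \<in> hom XZ integer_group" and b: "b \<in> carrier YZ"
    and feas: "primal_feasible XZ f b \<noteq> {} \<or> dual_feasible XZ YZ f c \<noteq> {}"
  shows "dual_value XZ YZ f b c = primal_value XZ f b c"
proof (cases "b \<in> f ` carrier XZ")
  case True
  then obtain x0 where x0: "x0 \<in> carrier XZ" "f x0 = b"
    by blast
  show ?thesis
  proof (cases "dual_feasible XZ YZ f c = {}")
    case False
    have "- l b = c x0" if "l \<in> dual_feasible XZ YZ f c" for l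
      using dual_feasibleD(2) [OF that x0(1)] x0(2) by simp
    then have dual: "dual_value XZ YZ f b c = ereal (of_int (c x0))"
      unfolding dual_value_def using False by (simp cong: SUP_cong)
    obtain l where l: "l \<in> dual_feasible XZ YZ f c"
      using False by blast
    have "c x = c x0" if "x \<in> primal_feasible XZ f b" for x
    proof -
      have "x \<in> carrier XZ" "f x = b"
        using that by (simp_all add: primal_feasible_def)
      then show ?thesis
        using dual_feasibleD(2) [OF l] x0 by metis
    qed
    moreover have "primal_feasible XZ f b \<noteq> {}"
      using x0 by (auto simp: primal_feasible_def)
    ultimately have "primal_value XZ f b c = ereal (of_int (c x0))"
      unfolding primal_value_def by (simp cong: INF_cong)
    with dual show ?thesis
      by simp
  next
    case True
    interpret X: comm_group XZ by fact
    interpret Y: comm_group YZ by fact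
    interpret f: group_hom XZ YZ f
      using assms(4) by (simp add: group_hom_def group_hom_axioms_def X.is_group Y.is_group)
    interpret c: group_hom XZ integer_group c
      using c by (simp add: group_hom_def group_hom_axioms_def X.is_group)
    obtain k where k: "k \<in> carrier XZ" "f k = \<one>\<^bsub>YZ\<^esub>" "c k \<noteq> 0"
      using True dual_feasible_if_zero_on_kernel [OF assms(1-4) tf c] by blast
    have "primal_value XZ f b c = - \<infinity>"
      unfolding primal_value_def
    proof (rule INF_of_int_eq_MInf)
      fix m
      obtain t where t: "c x0 + t * c k \<le> m"
        using ex_multiple_below [OF k(3)] by blast
      let ?x = "x0 \<otimes>\<^bsub>XZ\<^esub> k [^]\<^bsub>XZ\<^esub> t"
      have "c ?x = c x0 + t * c k"
        using x0 k c.hom_int_pow by simp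
      moreover have "?x \<in> primal_feasible XZ f b"
        using x0 k f.hom_int_pow b by (simp add: primal_feasible_def Y.int_pow_one)
      ultimately show "\<exists>x\<in>primal_feasible XZ f b. c x \<le> m"
        using t by metis
    qed
    then show ?thesis
      using True by (simp add: dual_value_def bot_ereal_def)
  qed
next
  case False
  then have empty: "primal_feasible XZ f b = {}"
    by (auto simp: primal_feasible_def)
  then obtain l where l: "l \<in> dual_feasible XZ YZ f c"
    using feas by blast
  interpret X: comm_group XZ by fact
  interpret Y: comm_group YZ by fact
  let ?N = "f ` carrier XZ" and ?C = "coker XZ YZ f"
  have N: "subgroup ?N YZ" and C: "comm_group ?C"
    using comm_group_coker [OF assms(2,4) X.is_group] by auto
  interpret N: normal ?N YZ
    by (rule Y.subgroup_imp_normal [OF N])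
  interpret C: comm_group ?C
    by (rule C)
  let ?p = "\<lambda>y. ?N #>\<^bsub>YZ\<^esub> y"
  have p: "?p \<in> hom YZ ?C"
    unfolding coker_def by (rule N.r_coset_hom_Mod)
  have p_one: "?p y = \<one>\<^bsub>?C\<^esub> \<longleftrightarrow> y \<in> ?N" if "y \<in> carrier YZ" for y
    using Y.coset_join1 [OF _ that N] Y.coset_join2 [OF that N] by (auto simp: coker_def)
  have fgC: "finitely_generated ?C"
    unfolding coker_def by (rule Y.finitely_generated_Mod [OF assms(3) N])
  obtain h where h: "h \<in> hom ?C integer_group" "h (?p b) \<noteq> 0"
    using C.torsion_free_separating_hom [OF fgC tf, of "?p b"] p b p_one [OF b] False
    by (auto simp: hom_def)
  have h_f: "h (?p (f x)) = 0" if "x \<in> carrier XZ" for x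
    using p_one [of "f x"] that hom_one [OF h(1) C.is_group group_integer_group] assms(4)
    by (auto simp: hom_def)
  have hp: "(\<lambda>y. h (?p y)) \<in> hom YZ integer_group"
    using hom_compose [OF p h(1)] by (simp add: comp_def)
  have feas_t: "(\<lambda>y. l y + t * h (?p y)) \<in> dual_feasible XZ YZ f c" for t
    using dual_feasibleD [OF l] hp h_f unfolding dual_feasible_def
    by (auto simp: hom_def algebra_simps)
  have "dual_value XZ YZ f b c = \<infinity>"
    unfolding dual_value_def
  proof (rule SUP_of_int_eq_PInf)
    fix m
    obtain t where "l b + t * h (?p b) \<le> - m"
      using ex_multiple_below [OF h(2)] by blast
    then have "m \<le> - (l b + t * h (?p b))"
      by linarith
    then show "\<exists>l\<in>dual_feasible XZ YZ f c. m \<le> - l b"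
      by (rule bexI [OF _ feas_t])
  qed
  then show ?thesis
    using empty by (simp add: primal_value_def top_ereal_def)
qed

section \<open>Presentation matrices\<close>

lemma lin_comb_eq_int_comb: "lin_comb G gs v = int_comb G {..<length gs} ((!) gs) (($) v)"
  by (simp add: lin_comb_def int_comb_def)

context comm_group
begin

lemma lin_comb_closed [simp]: "set gs \<subseteq> carrier G \<Longrightarrow> lin_comb G gs v \<in> carrier G"
  unfolding lin_comb_eq_int_comb by (rule int_comb_closed) (auto simp: subset_iff)

lemma lin_comb_add:
  assumes "set gs \<subseteq> carrier G" "v \<in> carrier_vec (length gs)" "w \<in> carrier_vec (length gs)"
  shows "lin_comb G gs (v + w) = lin_comb G gs v \<otimes> lin_comb G gs w"
proof -
  have gs: "(!) gs \<in> {..<length gs} \<rightarrow> carrier G"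
    using assms(1) by (auto simp: subset_iff)
  have "lin_comb G gs (v + w) = int_comb G {..<length gs} ((!) gs) (\<lambda>i. v $ i + w $ i)"
    unfolding lin_comb_eq_int_comb
    by (rule int_comb_cong [OF comm_group_axioms gs]) (use assms in auto)
  also have "\<dots> = lin_comb G gs v \<otimes> lin_comb G gs w"
    unfolding lin_comb_eq_int_comb by (rule int_comb_add [OF gs])
  finally show ?thesis .
qed

lemma lin_comb_smult:
  assumes "set gs \<subseteq> carrier G" "v \<in> carrier_vec (length gs)"
  shows "lin_comb G gs (n \<cdot>\<^sub>v v) = lin_comb G gs v [^] n"
proof -
  have gs: "(!) gs \<in> {..<length gs} \<rightarrow> carrier G"
    using assms(1) by (auto simp: subset_iff)
  have "lin_comb G gs (n \<cdot>\<^sub>v v) = int_comb G {..<length gs} ((!) gs) (\<lambda>i. v $ i * n)"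
    unfolding lin_comb_eq_int_comb
    by (rule int_comb_cong [OF comm_group_axioms gs]) (use assms in auto)
  also have "\<dots> = lin_comb G gs v [^] n"
    unfolding lin_comb_eq_int_comb by (rule int_comb_smult [OF gs])
  finally show ?thesis .
qed

lemma ex_lin_comb:
  assumes "set gs \<subseteq> carrier G" "generate G (set gs) = carrier G" "x \<in> carrier G"
  obtains v where "v \<in> carrier_vec (length gs)" "lin_comb G gs v = x"
proof -
  have gs: "(!) gs \<in> {..<length gs} \<rightarrow> carrier G"
    using assms(1) by (auto simp: subset_iff)
  have "(!) gs ` {..<length gs} = set gs"
    by (auto simp: set_conv_nth)
  then have "x \<in> range (int_comb G {..<length gs} ((!) gs))"
    using generate_eq_int_comb [OF _ gs] assms(2,3) by simp
  then obtain v where v: "x = int_comb G {..<length gs} ((!) gs) v"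
    by auto
  have "lin_comb G gs (vec (length gs) v) = x"
    unfolding lin_comb_eq_int_comb v
    by (rule int_comb_cong [OF comm_group_axioms gs]) auto
  then show ?thesis
    by (rule that [rotated]) simp
qed

end

lemma lin_comb_mult_mat_vec:
  assumes "comm_group XZ" "comm_group YZ" "f \<in> hom XZ YZ"
    and xs: "set xs \<subseteq> carrier XZ" and ys: "set ys \<subseteq> carrier YZ"
    and M: "M \<in> carrier_mat (length ys) (length xs)"
    and f_xs: "\<And>j. j < length xs \<Longrightarrow> lin_comb YZ ys (col M j) = f (xs ! j)"
    and w: "w \<in> carrier_vec (length xs)"
  shows "lin_comb YZ ys (M *\<^sub>v w) = f (lin_comb XZ xs w)"
proof -
  interpret X: comm_group XZ by fact
  interpret Y: comm_group YZ by fact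
  let ?I = "{..<length ys}" and ?J = "{..<length xs}"
  have gx: "(!) xs \<in> ?J \<rightarrow> carrier XZ" and gy: "(!) ys \<in> ?I \<rightarrow> carrier YZ"
    using xs ys by (auto simp: subset_iff)
  have "lin_comb YZ ys (M *\<^sub>v w) = int_comb YZ ?I ((!) ys) (\<lambda>i. \<Sum>j\<in>?J. M $$ (i, j) * w $ j)"
    unfolding lin_comb_eq_int_comb
    by (rule int_comb_cong [OF Y.comm_group_axioms gy])
       (use M w in \<open>auto simp: scalar_prod_def lessThan_atLeast0\<close>)
  also have "\<dots> = int_comb YZ ?J (\<lambda>j. int_comb YZ ?I ((!) ys) (\<lambda>i. M $$ (i, j))) (($) w)"
    by (rule Y.int_comb_swap [OF _ gy]) simp
  also have "\<dots> = int_comb YZ ?J (\<lambda>j. f (xs ! j)) (($) w)"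
  proof (rule int_comb_cong [OF Y.comm_group_axioms])
    fix j assume "j \<in> ?J"
    then have j: "j < length xs"
      by simp
    have "int_comb YZ ?I ((!) ys) (\<lambda>i. M $$ (i, j)) = lin_comb YZ ys (col M j)"
      unfolding lin_comb_eq_int_comb
      by (rule int_comb_cong [OF Y.comm_group_axioms gy]) (use M j in auto)
    then show "int_comb YZ ?I ((!) ys) (\<lambda>i. M $$ (i, j)) = f (xs ! j)"
      using f_xs [OF j] by simp
  qed (use gx assms(3) in \<open>auto simp: hom_def\<close>)
  also have "\<dots> = f (lin_comb XZ xs w)"
    unfolding lin_comb_eq_int_comb by (rule X.hom_int_comb [OF assms(3,2) gx, symmetric])
  finally show ?thesis .
qed

definition column_lattice :: "int mat \<Rightarrow> int vec set" where
  "column_lattice A = {A *\<^sub>v u | u. u \<in> carrier_vec (dim_col A)}"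

text \<open>
  Torsion-freeness of the quotient of \<open>\<int>\<close>-vectors of length \<open>m\<close> by \<open>L\<close>, stated without the quotient.
\<close>

definition saturated :: "nat \<Rightarrow> int vec set \<Rightarrow> bool" where
  "saturated m L \<longleftrightarrow> (\<forall>v\<in>carrier_vec m. \<forall>n. n \<noteq> 0 \<longrightarrow> n \<cdot>\<^sub>v v \<in> L \<longrightarrow> v \<in> L)"

text \<open>
  With \<open>A = [M | R]\<close>, the columns of \<open>M\<close> are the coefficients of generators of the image and the
  columns of \<open>R\<close> account for the ambiguity of coefficients, so membership in the image of \<open>f\<close>
  becomes membership in the lattice spanned by the columns of \<open>A\<close>.
\<close>

lemma presents_image_iff:
  assumes "comm_group XZ" "comm_group YZ" "f \<in> hom XZ YZ" "presents A XZ YZ f"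
  obtains ys where "set ys \<subseteq> carrier YZ" "generate YZ (set ys) = carrier YZ" "length ys = dim_row A"
    "\<And>v. v \<in> carrier_vec (dim_row A) \<Longrightarrow>
      lin_comb YZ ys v \<in> f ` carrier XZ \<longleftrightarrow> v \<in> column_lattice A"
proof -
  interpret X: comm_group XZ by fact
  interpret Y: comm_group YZ by fact
  obtain xs ys k M R where M: "M \<in> carrier_mat (length ys) (length xs)"
    and R: "R \<in> carrier_mat (length ys) k"
    and xs: "set xs \<subseteq> carrier XZ" "generate XZ (set xs) = carrier XZ"
    and ys: "set ys \<subseteq> carrier YZ" "generate YZ (set ys) = carrier YZ"
    and f_xs: "\<forall>j < length xs. lin_comb YZ ys (col M j) = f (xs ! j)"
    and rel: "{v \<in> carrier_vec (length ys). lin_comb YZ ys v = \<one>\<^bsub>YZ\<^esub>}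
      = {R *\<^sub>v w | w. w \<in> carrier_vec k}"
    and A: "A = four_block_mat M R (0\<^sub>m 0 (length xs)) (0\<^sub>m 0 k)"
    using assms(4) unfolding presents_def by blast
  have dims: "dim_row A = length ys" "dim_col A = length xs + k"
    using M R by (simp_all add: A)
  have lin_M: "lin_comb YZ ys (M *\<^sub>v u) = f (lin_comb XZ xs u)"
    if "u \<in> carrier_vec (length xs)" for u
    by (rule lin_comb_mult_mat_vec [OF assms(1-3) xs(1) ys(1) M _ that]) (use f_xs in simp)
  have f_closed: "f x \<in> carrier YZ" if "x \<in> carrier XZ" for x
    using assms(3) that by (auto simp: hom_def)
  have lin_R: "lin_comb YZ ys (R *\<^sub>v w) = \<one>\<^bsub>YZ\<^esub>" if "w \<in> carrier_vec k" for w
    using rel that by blast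
  have A_mult: "A *\<^sub>v (u @\<^sub>v w) = M *\<^sub>v u + R *\<^sub>v w"
    if "u \<in> carrier_vec (length xs)" "w \<in> carrier_vec k" for u w
  proof -
    have "A *\<^sub>v (u @\<^sub>v w)
        = (M *\<^sub>v u + R *\<^sub>v w) @\<^sub>v (0\<^sub>m 0 (length xs) *\<^sub>v u + 0\<^sub>m 0 k *\<^sub>v w)"
      unfolding A by (rule four_block_mat_mult_vec [OF M R zero_carrier_mat zero_carrier_mat that])
    also have "\<dots> = M *\<^sub>v u + R *\<^sub>v w"
      by (rule eq_vecI) simp_all
    finally show ?thesis .
  qed
  have "lin_comb YZ ys v \<in> f ` carrier XZ \<longleftrightarrow> v \<in> column_lattice A"
    if v: "v \<in> carrier_vec (dim_row A)" for v
  proof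
    assume "lin_comb YZ ys v \<in> f ` carrier XZ"
    then obtain x where x: "x \<in> carrier XZ" "lin_comb YZ ys v = f x"
      by blast
    obtain u where u: "u \<in> carrier_vec (length xs)" "lin_comb XZ xs u = x"
      using X.ex_lin_comb [OF xs x(1)] by blast
    have Mu: "M *\<^sub>v u \<in> carrier_vec (length ys)"
      using M u(1) by simp
    define r where "r = v + (- 1) \<cdot>\<^sub>v (M *\<^sub>v u)"
    have r: "r \<in> carrier_vec (length ys)"
      using v Mu dims by (simp add: r_def)
    have "lin_comb YZ ys r = lin_comb YZ ys v \<otimes>\<^bsub>YZ\<^esub> lin_comb YZ ys ((- 1) \<cdot>\<^sub>v (M *\<^sub>v u))"
      unfolding r_def by (rule Y.lin_comb_add [OF ys(1)]) (use v Mu dims in simp_all)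
    also have "\<dots> = f x \<otimes>\<^bsub>YZ\<^esub> f x [^]\<^bsub>YZ\<^esub> (- 1 :: int)"
      by (simp only: Y.lin_comb_smult [OF ys(1) Mu] lin_M [OF u(1)] u(2) x(2))
    also have "\<dots> = \<one>\<^bsub>YZ\<^esub>"
      using f_closed [OF x(1)] by (simp add: Y.int_pow_neg)
    finally have "lin_comb YZ ys r = \<one>\<^bsub>YZ\<^esub>" .
    then obtain w where w: "w \<in> carrier_vec k" "r = R *\<^sub>v w"
      using rel r by blast
    have "v = M *\<^sub>v u + r"
      using v Mu dims M by (intro eq_vecI) (auto simp: r_def)
    then have "v = A *\<^sub>v (u @\<^sub>v w)"
      using A_mult [OF u(1) w(1)] w(2) by simp
    then show "v \<in> column_lattice A"
      unfolding column_lattice_def dims using u(1) w(1) by auto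
  next
    assume "v \<in> column_lattice A"
    then obtain z where z: "z \<in> carrier_vec (length xs + k)" "v = A *\<^sub>v z"
      unfolding column_lattice_def dims by blast
    define u w where "u = vec_first z (length xs)" and "w = vec_last z k"
    have uw: "u \<in> carrier_vec (length xs)" "w \<in> carrier_vec k" "z = u @\<^sub>v w"
      using z(1) by (simp_all add: u_def w_def vec_first_last_append)
    have "lin_comb YZ ys v = lin_comb YZ ys (M *\<^sub>v u) \<otimes>\<^bsub>YZ\<^esub> lin_comb YZ ys (R *\<^sub>v w)"
      unfolding z(2) uw(3) A_mult [OF uw(1,2)]
      by (rule Y.lin_comb_add [OF ys(1)]) (use M R uw(1,2) in simp_all)
    also have "\<dots> = f (lin_comb XZ xs u)"
      using f_closed [OF X.lin_comb_closed [OF xs(1)]]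
      by (simp only: lin_M [OF uw(1)] lin_R [OF uw(2)] Y.r_one)
    finally have "lin_comb YZ ys v = f (lin_comb XZ xs u)" .
    then show "lin_comb YZ ys v \<in> f ` carrier XZ"
      using xs(1) by simp
  qed
  from ys dims(1) [symmetric] this show ?thesis
    by (rule that)
qed

lemma torsion_free_coker_iff_saturated:
  assumes "comm_group XZ" "comm_group YZ" "f \<in> hom XZ YZ" "presents A XZ YZ f"
  shows "torsion_free (coker XZ YZ f) \<longleftrightarrow> saturated (dim_row A) (column_lattice A)"
proof -
  interpret X: comm_group XZ by fact
  interpret Y: comm_group YZ by fact
  interpret f: group_hom XZ YZ f
    using assms(3) by (simp add: group_hom_def group_hom_axioms_def X.is_group Y.is_group)
  let ?N = "f ` carrier XZ"
  obtain ys where ys: "set ys \<subseteq> carrier YZ" "generate YZ (set ys) = carrier YZ"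
    and len: "length ys = dim_row A"
    and iff: "\<And>v. v \<in> carrier_vec (dim_row A) \<Longrightarrow> lin_comb YZ ys v \<in> ?N \<longleftrightarrow> v \<in> column_lattice A"
    using presents_image_iff [OF assms] by blast
  have pow: "lin_comb YZ ys (n \<cdot>\<^sub>v v) = lin_comb YZ ys v [^]\<^bsub>YZ\<^esub> n"
    if "v \<in> carrier_vec (dim_row A)" for v n
    using Y.lin_comb_smult [OF ys(1)] that len by simp
  have "torsion_free (coker XZ YZ f) \<longleftrightarrow>
      (\<forall>y\<in>carrier YZ. \<forall>n::int. n \<noteq> 0 \<longrightarrow> y [^]\<^bsub>YZ\<^esub> n \<in> ?N \<longrightarrow> y \<in> ?N)"
    unfolding coker_def by (rule Y.torsion_free_Mod_iff [OF f.img_is_subgroup])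
  also have "\<dots> \<longleftrightarrow> (\<forall>v\<in>carrier_vec (dim_row A). \<forall>n::int. n \<noteq> 0 \<longrightarrow>
      lin_comb YZ ys v [^]\<^bsub>YZ\<^esub> n \<in> ?N \<longrightarrow> lin_comb YZ ys v \<in> ?N)"
    using Y.ex_lin_comb [OF ys] Y.lin_comb_closed [OF ys(1)] unfolding len by metis
  also have "\<dots> \<longleftrightarrow> saturated (dim_row A) (column_lattice A)"
    unfolding saturated_def using iff pow by (metis smult_carrier_vec)
  finally show ?thesis .
qed

lemma inverse_mult_mat_vec:
  fixes A B :: "'a :: comm_ring_1 mat"
  assumes "A \<in> carrier_mat n n" "B \<in> carrier_mat n n" "B * A = 1\<^sub>m n" "v \<in> carrier_vec n"
  shows "B *\<^sub>v (A *\<^sub>v v) = v"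
  using assoc_mult_mat_vec [OF assms(2,1,4)] one_mult_mat_vec [OF assms(4)] assms(3) by metis

lemma mult_mat_vec_smult:
  fixes A :: "'a :: comm_ring_1 mat"
  assumes "A \<in> carrier_mat m n" "v \<in> carrier_vec n"
  shows "A *\<^sub>v (k \<cdot>\<^sub>v v) = k \<cdot>\<^sub>v (A *\<^sub>v v)"
  using assms by (intro eq_vecI) auto

lemma invertible_mat_inverse:
  assumes "A \<in> carrier_mat n n" "invertible_mat A"
  obtains B where "B \<in> carrier_mat n n" "A * B = 1\<^sub>m n" "B * A = 1\<^sub>m n"
proof -
  obtain B where B: "A * B = 1\<^sub>m n" "B * A = 1\<^sub>m (dim_row B)"
    using assms by (auto simp: invertible_mat_def inverts_mat_def)
  have "dim_col B = n"
    using arg_cong [OF B(1), of dim_col] by simp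
  moreover have "dim_row B = n"
    using arg_cong [OF B(2), of dim_col] assms(1) by simp
  ultimately show ?thesis
    using that B by (metis carrier_matI)
qed

text \<open>
  Column operations \<open>Q\<close> leave the column lattice as it is, and row operations \<open>P\<close> move it by the
  automorphism \<open>P\<close> of the ambient lattice.
\<close>

lemma mult_mem_column_lattice_iff:
  assumes P: "P \<in> carrier_mat (dim_row A) (dim_row A)" "P' \<in> carrier_mat (dim_row A) (dim_row A)"
    and Q: "Q \<in> carrier_mat (dim_col A) (dim_col A)" "Q' \<in> carrier_mat (dim_col A) (dim_col A)"
    and P': "P' * P = 1\<^sub>m (dim_row A)" and Q': "Q * Q' = 1\<^sub>m (dim_col A)"
    and v: "v \<in> carrier_vec (dim_row A)"
  shows "P *\<^sub>v v \<in> column_lattice (P * A * Q) \<longleftrightarrow> v \<in> column_lattice A"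
proof -
  have A: "A \<in> carrier_mat (dim_row A) (dim_col A)"
    by simp
  have PAQ: "(P * A * Q) *\<^sub>v u = P *\<^sub>v (A *\<^sub>v (Q *\<^sub>v u))" if "u \<in> carrier_vec (dim_col A)" for u
  proof -
    have "(P * A * Q) *\<^sub>v u = (P * A) *\<^sub>v (Q *\<^sub>v u)"
      using that by (intro assoc_mult_mat_vec [OF mult_carrier_mat [OF P(1) A] Q(1)])
    also have "\<dots> = P *\<^sub>v (A *\<^sub>v (Q *\<^sub>v u))"
      using that Q(1) by (intro assoc_mult_mat_vec [OF P(1) A]) simp
    finally show ?thesis .
  qed
  have dim_PAQ: "dim_col (P * A * Q) = dim_col A"
    using Q by simp
  show ?thesis
  proof
    assume "v \<in> column_lattice A"
    then obtain u where u: "u \<in> carrier_vec (dim_col A)" "v = A *\<^sub>v u"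
      unfolding column_lattice_def by blast
    have Q'u: "Q' *\<^sub>v u \<in> carrier_vec (dim_col A)"
      using Q u(1) by simp
    have "P *\<^sub>v v = (P * A * Q) *\<^sub>v (Q' *\<^sub>v u)"
      unfolding PAQ [OF Q'u] inverse_mult_mat_vec [OF Q(2,1) Q' u(1)] u(2) ..
    then show "P *\<^sub>v v \<in> column_lattice (P * A * Q)"
      unfolding column_lattice_def dim_PAQ using Q'u by blast
  next
    assume "P *\<^sub>v v \<in> column_lattice (P * A * Q)"
    then obtain u where u: "u \<in> carrier_vec (dim_col A)" "P *\<^sub>v v = (P * A * Q) *\<^sub>v u"
      unfolding column_lattice_def dim_PAQ by blast
    have Qu: "Q *\<^sub>v u \<in> carrier_vec (dim_col A)"
      using Q u(1) by simp
    have "v = P' *\<^sub>v (P *\<^sub>v (A *\<^sub>v (Q *\<^sub>v u)))"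
      using inverse_mult_mat_vec [OF P P' v] u PAQ by metis
    also have "\<dots> = A *\<^sub>v (Q *\<^sub>v u)"
      by (rule inverse_mult_mat_vec [OF P P' mult_mat_vec_carrier [OF A Qu]])
    finally show "v \<in> column_lattice A"
      unfolding column_lattice_def using Qu by blast
  qed
qed

lemma saturated_column_lattice_equivalent:
  assumes P: "P \<in> carrier_mat (dim_row A) (dim_row A)" "invertible_mat P"
    and Q: "Q \<in> carrier_mat (dim_col A) (dim_col A)" "invertible_mat Q"
  shows "saturated (dim_row A) (column_lattice (P * A * Q)) \<longleftrightarrow>
    saturated (dim_row A) (column_lattice A)"
proof -
  obtain P' where P': "P' \<in> carrier_mat (dim_row A) (dim_row A)"
    "P * P' = 1\<^sub>m (dim_row A)" "P' * P = 1\<^sub>m (dim_row A)"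
    using invertible_mat_inverse [OF P] by blast
  obtain Q' where Q': "Q' \<in> carrier_mat (dim_col A) (dim_col A)"
    "Q * Q' = 1\<^sub>m (dim_col A)" "Q' * Q = 1\<^sub>m (dim_col A)"
    using invertible_mat_inverse [OF Q] by blast
  note mem = mult_mem_column_lattice_iff [OF P(1) P'(1) Q(1) Q'(1) P'(3) Q'(2)]
  have scale: "P *\<^sub>v (n \<cdot>\<^sub>v v) = n \<cdot>\<^sub>v (P *\<^sub>v v)" if "v \<in> carrier_vec (dim_row A)" for n v
    by (rule mult_mat_vec_smult [OF P(1) that])
  have surj: "\<exists>w\<in>carrier_vec (dim_row A). v = P *\<^sub>v w" if v: "v \<in> carrier_vec (dim_row A)" for v
    using inverse_mult_mat_vec [OF P'(1) P(1) P'(2) v, symmetric] mult_mat_vec_carrier [OF P'(1) v]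
    by (rule bexI)
  have closed: "P *\<^sub>v v \<in> carrier_vec (dim_row A)" if "v \<in> carrier_vec (dim_row A)" for v
    using P(1) that by simp
  have "saturated (dim_row A) (column_lattice (P * A * Q)) \<longleftrightarrow>
      (\<forall>v\<in>carrier_vec (dim_row A). \<forall>n. n \<noteq> 0 \<longrightarrow>
        n \<cdot>\<^sub>v (P *\<^sub>v v) \<in> column_lattice (P * A * Q) \<longrightarrow> P *\<^sub>v v \<in> column_lattice (P * A * Q))"
    unfolding saturated_def using surj closed by metis
  also have "\<dots> \<longleftrightarrow> saturated (dim_row A) (column_lattice A)"
    unfolding saturated_def using mem scale by (metis smult_carrier_vec)
  finally show ?thesis .
qed

lemma diagonal_column_lattice_iff:
  assumes "diagonal_mat D"
  shows "v \<in> column_lattice D \<longleftrightarrow> v \<in> carrier_vec (dim_row D) \<and>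
    (\<forall>i<dim_row D. if i < dim_col D then D $$ (i, i) dvd v $ i else v $ i = 0)"
proof -
  have Du: "(D *\<^sub>v u) $ i = (if i < dim_col D then D $$ (i, i) * u $ i else 0)"
    if i: "i < dim_row D" and u: "u \<in> carrier_vec (dim_col D)" for u i
  proof -
    have "(D *\<^sub>v u) $ i = (\<Sum>j\<in>{0..<dim_col D}. D $$ (i, j) * u $ j)"
      using i u by (auto simp: scalar_prod_def)
    also have "\<dots> = (\<Sum>j\<in>{0..<dim_col D}. if j = i then D $$ (i, i) * u $ i else 0)"
      by (rule sum.cong) (use assms i in \<open>auto simp: diagonal_mat_def\<close>)
    also have "\<dots> = (if i < dim_col D then D $$ (i, i) * u $ i else 0)"
      by simp
    finally show ?thesis .
  qed
  show ?thesis
  proof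
    assume "v \<in> column_lattice D"
    then obtain u where u: "u \<in> carrier_vec (dim_col D)" "v = D *\<^sub>v u"
      unfolding column_lattice_def by blast
    have "if i < dim_col D then D $$ (i, i) dvd v $ i else v $ i = 0" if "i < dim_row D" for i
      unfolding u(2) Du [OF that u(1)] by simp
    moreover have "v \<in> carrier_vec (dim_row D)"
      unfolding u(2) by (rule mult_mat_vec_carrier [OF _ u(1)]) simp
    ultimately show "v \<in> carrier_vec (dim_row D) \<and>
        (\<forall>i<dim_row D. if i < dim_col D then D $$ (i, i) dvd v $ i else v $ i = 0)"
      by blast
  next
    assume v: "v \<in> carrier_vec (dim_row D) \<and>
      (\<forall>i<dim_row D. if i < dim_col D then D $$ (i, i) dvd v $ i else v $ i = 0)"
    define u where "u = vec (dim_col D) (\<lambda>i. v $ i div D $$ (i, i))"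
    have u: "u \<in> carrier_vec (dim_col D)"
      by (simp add: u_def)
    have "v = D *\<^sub>v u"
    proof (rule eq_vecI)
      fix i assume "i < dim_vec (D *\<^sub>v u)"
      then have i: "i < dim_row D"
        by simp
      with v have "if i < dim_col D then D $$ (i, i) dvd v $ i else v $ i = 0"
        by blast
      then show "v $ i = (D *\<^sub>v u) $ i"
        unfolding Du [OF i u] by (auto simp: u_def)
    qed (use v in simp)
    then show "v \<in> column_lattice D"
      unfolding column_lattice_def by (auto simp: u_def)
  qed
qed

text \<open>
  The lattice of a diagonal matrix is a product of the subgroups of multiples of the \<open>D $$ (i, i)\<close>
  (and of zero subgroups in the surplus rows), and the multiples of \<open>d \<ge> 0\<close> are saturated in \<open>\<int>\<close>
  exactly for \<open>d = 0\<close> and \<open>d = 1\<close>.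
\<close>

lemma saturated_diagonal_iff:
  assumes diag: "diagonal_mat D"
    and nonneg: "\<forall>i < min (dim_row D) (dim_col D). 0 \<le> D $$ (i, i)"
  shows "saturated (dim_row D) (column_lattice D) \<longleftrightarrow> (\<forall>d \<in> invariant_factors D. d = 1)"
proof
  assume sat: "saturated (dim_row D) (column_lattice D)"
  show "\<forall>d \<in> invariant_factors D. d = 1"
  proof
    fix d assume "d \<in> invariant_factors D"
    then obtain i where i: "i < dim_row D" "i < dim_col D" and d: "d = D $$ (i, i)" "d \<noteq> 0"
      by (auto simp: invariant_factors_def)
    have "d \<cdot>\<^sub>v unit_vec (dim_row D) i \<in> column_lattice D"
      unfolding diagonal_column_lattice_iff [OF diag] using i d(1) by auto
    then have "unit_vec (dim_row D) i \<in> column_lattice D"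
      by (rule sat [unfolded saturated_def, rule_format, OF unit_vec_carrier d(2)])
    then have "d dvd unit_vec (dim_row D) i $ i"
      using i d(1) unfolding diagonal_column_lattice_iff [OF diag] by presburger
    then have "d dvd 1"
      using i by simp
    then show "d = 1"
      using nonneg i d(1) by auto
  qed
next
  assume one: "\<forall>d \<in> invariant_factors D. d = 1"
  have D_ii: "D $$ (i, i) = 0 \<or> D $$ (i, i) = 1" if "i < dim_row D" "i < dim_col D" for i
    using one that by (auto simp: invariant_factors_def)
  show "saturated (dim_row D) (column_lattice D)"
    unfolding saturated_def diagonal_column_lattice_iff [OF diag]
  proof (intro ballI allI impI conjI)
    fix v :: "int vec" and n :: int and i
    assume v: "v \<in> carrier_vec (dim_row D)" and n: "n \<noteq> 0" and i: "i < dim_row D"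
      and nv: "n \<cdot>\<^sub>v v \<in> carrier_vec (dim_row D) \<and>
        (\<forall>i<dim_row D. if i < dim_col D then D $$ (i, i) dvd (n \<cdot>\<^sub>v v) $ i else (n \<cdot>\<^sub>v v) $ i = 0)"
    from nv i have "if i < dim_col D then D $$ (i, i) dvd (n \<cdot>\<^sub>v v) $ i else (n \<cdot>\<^sub>v v) $ i = 0"
      by blast
    then show "if i < dim_col D then D $$ (i, i) dvd v $ i else v $ i = 0"
      using D_ii [OF i] n v i by (cases "i < dim_col D") auto
  qed
qed

section \<open>The equivalence\<close>

theorem lemma6p7:
  fixes XZ :: "('a, 'm) monoid_scheme" and YZ :: "('b, 'n) monoid_scheme" and f :: "'a \<Rightarrow> 'b"
  assumes "comm_group XZ" and "finitely_generated XZ"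
    and "comm_group YZ" and "finitely_generated YZ"
    and "f \<in> hom XZ YZ"
  shows
    "((\<forall>c \<in> hom XZ integer_group. \<forall>b \<in> carrier YZ.
         primal_feasible XZ f b \<noteq> {} \<or> dual_feasible XZ YZ f c \<noteq> {} \<longrightarrow>
         dual_value XZ YZ f b c = primal_value XZ f b c)
       \<longleftrightarrow> trivial_group (Ext1 (coker XZ YZ f) integer_group)) \<and>
     (trivial_group (Ext1 (coker XZ YZ f) integer_group) \<longleftrightarrow> torsion_free (coker XZ YZ f)) \<and>
     (\<forall>A D. presents A XZ YZ f \<longrightarrow> smith_normal_form A D \<longrightarrow>
        (torsion_free (coker XZ YZ f) \<longleftrightarrow> (\<forall>d \<in> invariant_factors D. d = 1)))"
proof (intro conjI allI impI)
  interpret X: comm_group XZ by fact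
  interpret Y: comm_group YZ by fact
  have N: "subgroup (f ` carrier XZ) YZ" and C: "comm_group (coker XZ YZ f)"
    using comm_group_coker [OF assms(3,5) X.is_group] by auto
  have fgC: "finitely_generated (coker XZ YZ f)"
    unfolding coker_def by (rule Y.finitely_generated_Mod [OF assms(4) N])
  show Ext: "trivial_group (Ext1 (coker XZ YZ f) integer_group) \<longleftrightarrow> torsion_free (coker XZ YZ f)"
    using torsion_free_if_trivial_Ext1 [OF C fgC]
      trivial_Ext1_if_torsion_free [OF C fgC _ abelian_integer_group] by blast
  show "(\<forall>c \<in> hom XZ integer_group. \<forall>b \<in> carrier YZ.
       primal_feasible XZ f b \<noteq> {} \<or> dual_feasible XZ YZ f c \<noteq> {} \<longrightarrow>
       dual_value XZ YZ f b c = primal_value XZ f b c)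
     \<longleftrightarrow> trivial_group (Ext1 (coker XZ YZ f) integer_group)"
    unfolding Ext
  proof
    assume duality: "\<forall>c \<in> hom XZ integer_group. \<forall>b \<in> carrier YZ.
       primal_feasible XZ f b \<noteq> {} \<or> dual_feasible XZ YZ f c \<noteq> {} \<longrightarrow>
       dual_value XZ YZ f b c = primal_value XZ f b c"
    show "torsion_free (coker XZ YZ f)"
      by (rule torsion_free_coker_if_duality [OF assms(1,3,5)]) (use duality in simp)
  next
    assume tf: "torsion_free (coker XZ YZ f)"
    show "\<forall>c \<in> hom XZ integer_group. \<forall>b \<in> carrier YZ.
       primal_feasible XZ f b \<noteq> {} \<or> dual_feasible XZ YZ f c \<noteq> {} \<longrightarrow>
       dual_value XZ YZ f b c = primal_value XZ f b c"
      using duality_if_torsion_free_coker [OF assms(1,3,4,5) tf] by simp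
  qed
next
  fix A D assume A: "presents A XZ YZ f" and D: "smith_normal_form A D"
  obtain P Q where P: "P \<in> carrier_mat (dim_row A) (dim_row A)" "invertible_mat P"
    and Q: "Q \<in> carrier_mat (dim_col A) (dim_col A)" "invertible_mat Q"
    and PAQ: "D = P * A * Q" and diag: "diagonal_mat D"
    and nonneg: "\<forall>i < min (dim_row D) (dim_col D). 0 \<le> D $$ (i, i)"
    using D unfolding smith_normal_form_def by blast
  have dim: "dim_row D = dim_row A"
    using P(1) by (simp add: PAQ)
  have "torsion_free (coker XZ YZ f) \<longleftrightarrow> saturated (dim_row A) (column_lattice A)"
    by (rule torsion_free_coker_iff_saturated [OF assms(1,3,5) A])
  also have "\<dots> \<longleftrightarrow> saturated (dim_row D) (column_lattice D)"
    unfolding dim unfolding PAQ by (rule saturated_column_lattice_equivalent [OF P Q, symmetric])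
  also have "\<dots> \<longleftrightarrow> (\<forall>d \<in> invariant_factors D. d = 1)"
    by (rule saturated_diagonal_iff [OF diag nonneg])
  finally show "torsion_free (coker XZ YZ f) \<longleftrightarrow> (\<forall>d \<in> invariant_factors D. d = 1)" .
qed

end
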